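(* Let $n>d\ge 1$ be integers, let $X\in\mathbb{R}^{n\times d}$ have full column rank, let $y,\epsilon\in\mathbb{R}^n$, $\beta^*\in\mathbb{R}^d$ and $P^*\in\Pi_n$ satisfy $P^*y=X\beta^*+\epsilon$, and let $r\ge 0$ be an integer with $\mathrm{dist}(P^*,I_n)\le r$. Suppose the following hold. (A1) There are constants $U>L>0$ such that $\max_{i,j\in[n]}|y_i-y_j|\le U$ and $|(P^*y)_i-y_i|\ge L$ for all $i\in\mathrm{supp}(P^* )$. (A2) $R=10C_1rU^2/L^2+4$ for some constant $C_1>1$. (A3) There is a constant $\rho_n$ with $\rho_n=O(d\log(n)/n)$ (i.e. $\rho_n\le C_0\,d\log(n)/n$ for a constant $C_0>0$) such that $R\rho_n\le L^2/(90U^2)$, $\|Hu\|^2\le\rho_n\|u\|^2$ for all $u\in\mathcal{B}_4$, and $\|Hu\|^2\le R\rho_n\|u\|^2$ for all $u\in\mathcal{B}_{2R}$. (A4) There is a constant $\bar\sigma\ge 0$ with $\bar\sigma\le\min\{0.5,(\rho_nd)^{-1/2}\}\,L^2/(80U)$ such that $\|\widetilde H\epsilon\|_\infty\le\bar\sigma$, $\|\epsilon\|_\infty\le\bar\sigma$ and $\|H\epsilon\|\le\sqrt d\,\bar\sigma$. (B1) $R^2\rho_n\le 1/10$. (B2) There is a constant $\sigma\ge 0$ such that $\bar\sigma^2\le\sigma^2\min\{n/(660R^2),\,n/(5dR)\}$ and $\|\widetilde H\epsilon\|^2\ge\frac12 n\sigma^2$. (C) There is a constant $\bar\gamma>0$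 such that $\lambda_{\min}(\frac1nX^\top X)\ge\bar\gamma$ and $\|(X^\top X)^{-1}X^\top\epsilon\|\le\bar\sigma\sqrt{d/(n\bar\gamma)}$. Let $\{P^{(k)}\}_{k\ge 0}$ be the permutation matrices generated by the local search algorithm with parameter $R$, and suppose that iteration $k$ satisfies $G(P^{(k)})\le c\,\bar\sigma^2$ for a constant $c>0$. Let $\beta^{(k)}:=(X^\top X)^{-1}X^\top P^{(k)}y$ and $\bar c:=800+10c$. Then $$\|\beta^{(k)}-\beta^*\|^2\le 4\bar\gamma^{-1}\bar c\,\frac{R\bar\sigma^2}{n}+2\bar\gamma^{-1}\frac{d\bar\sigma^2}{n}$$ and $$\frac1n\Big\|(P^{(k)})^{-1}X\beta^{(k)}-(P^* )^{-1}X\beta^*\Big\|^2\le 2(\sqrt{2\bar c}+3)^2\frac{R\bar\sigma^2}{n}+\frac{2d\bar\sigma^2}{n}.$$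
   Context: $\Pi_n$ is the set of $n\times n$ permutation matrices; for $P\in\Pi_n$, $\pi_P$ is the permutation of $[n]=\{1,\dots,n\}$ with $\pi_P(i)=j$ iff $P_{ij}=1$ (so $(Py)_i=y_{\pi_P(i)}$). $\mathrm{dist}(P,Q)=\#\{i\in[n]:\pi_P(i)\ne\pi_Q(i)\}$ and $\mathrm{supp}(P)=\{i\in[n]:\pi_P(i)\ne i\}$. $\|\cdot\|$ is the Euclidean norm and $\|\cdot\|_\infty$ the $\ell_\infty$-norm; $\lambda_{\min}$ is the smallest eigenvalue. $\mathcal{B}_m$ is the set of vectors in $\mathbb{R}^n$ with at most $m$ nonzero entries. $H=X(X^\top X)^{-1}X^\top$ and $\widetilde H=I_n-H$. Local search algorithm with parameter $R$: $P^{(0)}=I_n$ and, for $k=0,1,2,\dots$, $P^{(k+1)}$ is any element of $$\operatorname{argmin}\{\|\widetilde HPy\|^2:\ P\in\Pi_n,\ \mathrm{dist}(P,P^{(k)})\le 2,\ \mathrm{dist}(P,I_n)\le R\}.$$ For $Q\in\Pi_n$, $G(Q):=\|\widetilde HQy\|^2-\min\{\|\widetilde HPy\|^2:\ P\in\Pi_n,\ \mathrm{dist}(P,Q)\le 2,\ \mathrm{dist}(P,I_n)\le R\}$. *)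

theory Defs
  imports "HOL-Analysis.Analysis"
begin

section \<open>Permutation matrices\<close>

text \<open>
  The index set \<open>[n]\<close> is a finite type \<open>'n\<close>, so that \<open>n = CARD('n)\<close>.
\<close>

definition perm_matrices :: "(real^'n^'n) set" where
  "perm_matrices = {P. (\<forall>i j. P $ i $ j \<in> {0, 1}) \<and>
     (\<forall>i. \<exists>!j. P $ i $ j = 1) \<and> (\<forall>j. \<exists>!i. P $ i $ j = 1)}"

definition perm_of :: "real^'n^'n \<Rightarrow> 'n \<Rightarrow> 'n" where
  "perm_of P i = (THE j. P $ i $ j = 1)"

definition perm_dist :: "real^'n^'n \<Rightarrow> real^'n^'n \<Rightarrow> nat" where
  "perm_dist P Q = card {i. perm_of P i \<noteq> perm_of Q i}"

definition perm_supp :: "real^'n^'n \<Rightarrow> 'n set" where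
  "perm_supp P = {i. perm_of P i \<noteq> i}"


section \<open>Linear algebra\<close>

definition sparse_vectors :: "real \<Rightarrow> (real^'n) set" where
  "sparse_vectors m = {u. real (card {i. u $ i \<noteq> 0}) \<le> m}"

text \<open>
  The set of real eigenvalues is always finite; it is nonempty for symmetric \<open>A\<close>, the only case
  of interest here.
\<close>

definition lambda_min :: "real^'n^'n \<Rightarrow> real" where
  "lambda_min A = Min {l. \<exists>v. v \<noteq> 0 \<and> A *v v = l *\<^sub>R v}"

text \<open>
  \<open>ls_coeff X v\<close> is the least squares coefficient vector of \<open>v\<close>. The inverse of the Gram matrix
  is a genuine one only if \<open>X\<close> has full column rank.
\<close>

definition ls_coeff :: "real^'d^'n \<Rightarrow> real^'n \<Rightarrow> real^'d" where
  "ls_coeff X v = (matrix_inv (transpose X ** X) ** transpose X) *v v"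

definition hat_matrix :: "real^'d^'n \<Rightarrow> real^'n^'n" where
  "hat_matrix X = X ** matrix_inv (transpose X ** X) ** transpose X"

definition residual_matrix :: "real^'d^'n \<Rightarrow> real^'n^'n" where
  "residual_matrix X = mat 1 - hat_matrix X"


section \<open>The local search algorithm\<close>

definition objective :: "real^'d^'n \<Rightarrow> real^'n \<Rightarrow> real^'n^'n \<Rightarrow> real" where
  "objective X y P = (norm (residual_matrix X *v (P *v y)))\<^sup>2"

definition search_nbhd :: "real \<Rightarrow> real^'n^'n \<Rightarrow> (real^'n^'n) set" where
  "search_nbhd R Q = {P \<in> perm_matrices. perm_dist P Q \<le> 2 \<and> real (perm_dist P (mat 1)) \<le> R}"

text \<open>
  The minimiser chosen in a step need not be unique, so the iterates are described by a
  predicate on sequences.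
\<close>

definition local_search_iterates ::
    "real^'d^'n \<Rightarrow> real^'n \<Rightarrow> real \<Rightarrow> (nat \<Rightarrow> real^'n^'n) \<Rightarrow> bool" where
  "local_search_iterates X y R P \<longleftrightarrow> P 0 = mat 1 \<and>
     (\<forall>k. is_arg_min (objective X y) (\<lambda>Q. Q \<in> search_nbhd R (P k)) (P (Suc k)))"

definition local_gap :: "real^'d^'n \<Rightarrow> real^'n \<Rightarrow> real \<Rightarrow> real^'n^'n \<Rightarrow> real" where
  "local_gap X y R Q = objective X y Q - (MIN P\<in>search_nbhd R Q. objective X y P)"

end

theory Submission
  imports Defs
begin

text \<open>
  For a feasible \<open>Q\<close> put \<open>v = Qy - P\<^sup>*y\<close>. Since \<open>H\<close> nearly annihilates sparse vectors, the
  objective is a perturbation of \<open>\<parallel>v\<parallel>\<^sup>2\<close>, and exchanging two rows \<open>i\<close>, \<open>j\<close> changes it by about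
  \<open>2AZ\<close>, where \<open>A\<close> and \<open>Z\<close> are the differences of the entries \<open>i\<close> and \<open>j\<close> of \<open>Qy\<close> and \<open>P\<^sup>*y\<close>. A
  crossing argument yields an exchange that gains a fixed multiple of \<open>\<parallel>v\<parallel>\<^sub>\<infinity>\<^sup>2\<close> up to noise, so a small
  local gap forces a small \<open>v\<close>, provided that the exchange is feasible. It is feasible if
  \<open>dist(Q, I) \<le> R - 2\<close> or \<open>supp(P\<^sup>*) \<subseteq> supp(Q)\<close>, and the latter holds as soon as \<open>\<parallel>v\<parallel>\<^sub>\<infinity> < L\<close>. Along
  the iterates \<open>\<parallel>v\<parallel>\<^sub>\<infinity> < L\<close> is reached within about \<open>R/2\<close> steps, because every earlier step gains a
  multiple of \<open>L\<^sup>2\<close>, and it persists afterwards, because an improving exchange cannot increase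
  \<open>\<parallel>v\<parallel>\<^sub>\<infinity>\<close> beyond noise level.
\<close>

section \<open>Permutation matrices\<close>

lemma perm_matrix_nth:
  assumes "P \<in> perm_matrices"
  shows "P $ i $ j = (if j = perm_of P i then 1 else 0)"
proof -
  have ex1: "\<exists>!j. P $ i $ j = 1" and vals: "P $ i $ j \<in> {0, 1}"
    using assms by (auto simp: perm_matrices_def)
  have "P $ i $ perm_of P i = 1"
    unfolding perm_of_def by (rule theI'[OF ex1])
  then show ?thesis
    using ex1 vals by auto
qed

lemma bij_perm_of:
  assumes "P \<in> perm_matrices"
  shows "bij (perm_of P)"
proof -
  have "\<exists>!i. perm_of P i = j" for j
  proof -
    have "\<exists>!i. P $ i $ j = 1"
      using assms by (auto simp: perm_matrices_def)
    moreover have "P $ i $ j = 1 \<longleftrightarrow> perm_of P i = j" for i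
      using perm_matrix_nth[OF assms, of i j] by auto
    ultimately show ?thesis by simp
  qed
  then show ?thesis by (metis bij_iff)
qed

lemma perm_matrix_mult_nth:
  assumes "P \<in> perm_matrices"
  shows "(P *v u) $ i = u $ perm_of P i"
  by (simp add: matrix_vector_mult_def perm_matrix_nth[OF assms] if_distrib[of "\<lambda>c. c * _"] cong: if_cong)

definition matrix_of_perm :: "('n \<Rightarrow> 'n) \<Rightarrow> real^'n^'n" where
  "matrix_of_perm \<pi> = (\<chi> i j. if j = \<pi> i then 1 else 0)"

lemma perm_of_matrix_of_perm [simp]: "perm_of (matrix_of_perm \<pi>) = \<pi>"
  by (auto simp: perm_of_def matrix_of_perm_def fun_eq_iff)

lemma matrix_of_perm_in: "bij \<pi> \<Longrightarrow> matrix_of_perm \<pi> \<in> perm_matrices"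
  by (auto simp: perm_matrices_def matrix_of_perm_def bij_iff) metis+

lemma matrix_of_perm_perm_of:
  assumes "P \<in> perm_matrices"
  shows "matrix_of_perm (perm_of P) = P"
  using perm_matrix_nth[OF assms] by (simp add: matrix_of_perm_def vec_eq_iff)

lemma finite_perm_matrices: "finite (perm_matrices :: (real^'n^'n) set)"
proof (rule finite_subset)
  show "perm_matrices \<subseteq> range (matrix_of_perm :: ('n \<Rightarrow> 'n) \<Rightarrow> _)"
    using matrix_of_perm_perm_of by (metis rangeI subsetI)
qed simp

lemma mat_1_eq_matrix_of_perm: "mat 1 = matrix_of_perm id"
  by (auto simp: mat_def matrix_of_perm_def vec_eq_iff)

lemma mat_1_perm_matrix: "mat 1 \<in> perm_matrices"
  by (simp add: mat_1_eq_matrix_of_perm matrix_of_perm_in)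

lemma perm_of_mat_1: "perm_of (mat 1) = id"
  by (simp add: mat_1_eq_matrix_of_perm)

lemma perm_dist_eq_card_supp: "perm_dist P (mat 1) = card (perm_supp P)"
  by (simp add: perm_dist_def perm_supp_def perm_of_mat_1)

lemma perm_dist_commute: "perm_dist P Q = perm_dist Q P"
  unfolding perm_dist_def by (rule arg_cong[where f = card]) auto

lemma perm_dist_self [simp]: "perm_dist P P = 0"
  by (simp add: perm_dist_def)

lemma perm_dist_triangle: "perm_dist P S \<le> perm_dist P Q + perm_dist Q S"
proof -
  have "{i. perm_of P i \<noteq> perm_of S i} \<subseteq>
      {i. perm_of P i \<noteq> perm_of Q i} \<union> {i. perm_of Q i \<noteq> perm_of S i}" by auto
  then show ?thesis
    unfolding perm_dist_def
    by (meson card_Un_le card_mono finite le_trans)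
qed

section \<open>Inverses of permutation matrices\<close>

lemma matrix_inv_mult:
  fixes A :: "real^'n^'n"
  assumes "invertible A"
  shows "A ** matrix_inv A = mat 1" "matrix_inv A ** A = mat 1"
  unfolding matrix_inv_def
  using someI_ex[OF assms[unfolded invertible_def]] by auto

lemma matrix_inv_eqI:
  fixes A B :: "real^'n^'n"
  assumes "A ** B = mat 1"
  shows "matrix_inv A = B"
proof -
  have "invertible A"
    using assms matrix_left_right_inverse[of A B] by (auto simp: invertible_def)
  then have "matrix_inv A ** (A ** B) = B"
    by (simp add: matrix_mul_assoc matrix_inv_mult)
  then show ?thesis by (simp add: assms)
qed

lemma matrix_inv_perm_matrix_nth:
  assumes "P \<in> perm_matrices"
  shows "(matrix_inv P *v u) $ perm_of P i = u $ i"
proof -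
  let ?\<sigma> = "inv (perm_of P)"
  have b: "bij (perm_of P)" and b': "bij ?\<sigma>"
    using bij_perm_of[OF assms] by (auto simp: bij_imp_bij_inv)
  have "P ** matrix_of_perm ?\<sigma> = mat 1"
    using b
    by (auto simp: matrix_eq matrix_vector_mul_assoc[symmetric] vec_eq_iff
        perm_matrix_mult_nth[OF assms] perm_matrix_mult_nth[OF matrix_of_perm_in[OF b']]
        bij_is_inj)
  then have "matrix_inv P = matrix_of_perm ?\<sigma>"
    by (rule matrix_inv_eqI)
  then show ?thesis
    using b by (simp add: perm_matrix_mult_nth[OF matrix_of_perm_in[OF b']] bij_is_inj)
qed

lemma matrix_inv_perm_matrix_cancel:
  assumes "P \<in> perm_matrices"
  shows "matrix_inv P *v (P *v u) = u"
proof -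
  have "(matrix_inv P *v (P *v u)) $ j = u $ j" for j
  proof -
    obtain i where "j = perm_of P i"
      using bij_perm_of[OF assms] by (metis bij_pointE)
    then show ?thesis
      by (simp add: matrix_inv_perm_matrix_nth[OF assms] perm_matrix_mult_nth[OF assms])
  qed
  then show ?thesis by (simp add: vec_eq_iff)
qed

lemma norm_matrix_inv_perm_matrix:
  assumes "P \<in> perm_matrices"
  shows "norm (matrix_inv P *v u) = norm u"
proof -
  have "(\<Sum>j\<in>UNIV. ((matrix_inv P *v u) $ j)\<^sup>2) = (\<Sum>i\<in>UNIV. (u $ i)\<^sup>2)"
    using sum.reindex_bij_betw[OF bij_perm_of[OF assms], of "\<lambda>j. ((matrix_inv P *v u) $ j)\<^sup>2"]
    by (simp add: matrix_inv_perm_matrix_nth[OF assms])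
  then show ?thesis
    by (simp add: norm_vec_def L2_set_def)
qed

section \<open>Transpositions and crossing pairs\<close>

text \<open>The place \<open>j\<close> where \<open>Q\<close> takes the value
  \<open>perm_of P i\<close> is a second place of disagreement, so the permutations differ exactly
  at \<open>i\<close> and \<open>j\<close>. The preimage of \<open>perm_of P j\<close> under
  \<open>perm_of Q\<close> can then only be \<open>i\<close>.\<close>

lemma perm_dist_le_2_cases:
  assumes "P \<in> perm_matrices" "Q \<in> perm_matrices" "perm_dist P Q \<le> 2"
  obtains "perm_of P = perm_of Q"
  | i j where "i \<noteq> j" "perm_of P = perm_of Q \<circ> Transposition.transpose i j"
proof (cases "perm_of P = perm_of Q")
  case False
  let ?p = "perm_of P" and ?q = "perm_of Q" and ?D = "{k. perm_of P k \<noteq> perm_of Q k}"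
  note p = bij_perm_of[OF assms(1)] and q = bij_perm_of[OF assms(2)]
  from False obtain i where i: "?p i \<noteq> ?q i" by auto
  obtain j where j: "?q j = ?p i" using q by (metis bij_pointE)
  have ij: "i \<noteq> j" using i j by auto
  have jD: "?p j \<noteq> ?q j" using p j ij by (metis bij_pointE)
  have "{i, j} = ?D"
  proof (rule card_seteq)
    show "card ?D \<le> card {i, j}"
      using assms(3) ij by (simp add: perm_dist_def)
  qed (use i jD in auto)
  then have out: "?p k = ?q k" if "k \<noteq> i" "k \<noteq> j" for k
    using that by blast
  obtain k where k: "?q k = ?p j" using q by (metis bij_pointE)
  have "k = i"
    using out[of k] k jD p by (metis bij_pointE)
  then have "?p = ?q \<circ> Transposition.transpose i j"
    using out j k by (auto simp: fun_eq_iff Transposition.transpose_def)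
  then show ?thesis using that(2) ij by blast
qed (use that in blast)

text \<open>Since \<open>a\<close> and \<open>z\<close> take the same values, the jump of \<open>a\<close> over the midpoint of
  \<open>z i\<close> and \<open>a i\<close> at position \<open>i\<close> is compensated by a jump in the other direction at some
  position \<open>j\<close>.\<close>

lemma crossing_swap_aux:
  fixes a z :: "'n::finite \<Rightarrow> real"
  assumes \<pi>: "bij \<pi>" and a: "a = z \<circ> \<pi>" and i: "z i < a i"
  obtains j where "a j \<le> (a i + z i) / 2" "(a i + z i) / 2 < z j"
proof -
  define m where "m = (a i + z i) / 2"
  let ?A = "{k. m < a k}" and ?Z = "{k. m < z k}"
  have "\<pi> ` ?A = ?Z"
    using \<pi> a by (auto simp: bij_def surj_def image_iff)
  then have card_eq: "card ?Z = card ?A"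
    using \<pi> by (metis bij_def card_image inj_on_subset subset_UNIV)
  have "i \<in> ?A" "i \<notin> ?Z" using i by (auto simp: m_def)
  then have "\<not> ?Z \<subseteq> ?A"
    using card_eq card_subset_eq[of ?A ?Z] by auto
  then show ?thesis using that by (force simp: m_def)
qed

text \<open>The midpoint of \<open>a i\<close> and \<open>z i\<close> separates \<open>a i\<close>
  from \<open>a j\<close> and \<open>z i\<close> from \<open>z j\<close>, in opposite orders. Both
  \<open>a i\<close> and \<open>z i\<close> are half the error away from it, hence the two lower
  bounds. The case \<open>a i < z i\<close> is the other one with all signs reversed.\<close>

lemma crossing_swap:
  fixes a z :: "'n::finite \<Rightarrow> real"
  assumes \<pi>: "bij \<pi>" and a: "a = z \<circ> \<pi>" and i: "a i \<noteq> z i"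
  obtains j where "j \<noteq> i" "a j \<noteq> z j" "(a i - a j) * (z i - z j) \<le> 0"
    "\<bar>a i - z i\<bar> / 2 \<le> \<bar>a i - a j\<bar>" "\<bar>a i - z i\<bar> / 2 \<le> \<bar>z i - z j\<bar>"
proof (cases "z i < a i")
  case True
  obtain j where "a j \<le> (a i + z i) / 2" "(a i + z i) / 2 < z j"
    using crossing_swap_aux[OF \<pi> a True] .
  then show ?thesis
    using True by (intro that[of j] mult_nonneg_nonpos) (auto simp: field_simps)
next
  case False
  obtain j where "- a j \<le> (- a i + - z i) / 2" "(- a i + - z i) / 2 < - z j"
    using crossing_swap_aux[OF \<pi>, of "\<lambda>k. - a k" "\<lambda>k. - z k" i] a i False by (auto simp: o_def)
  then show ?thesis
    using False i by (intro that[of j] mult_nonpos_nonneg) (auto simp: field_simps)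
qed

section \<open>Hat matrix and smallest eigenvalue\<close>

lemma inner_matrix_vector_transpose:
  fixes A :: "real^'m^'n"
  shows "x \<bullet> (A *v y) = (transpose A *v x) \<bullet> y"
  by (metis dot_lmul_matrix transpose_matrix_vector)

lemma norm_matrix_vector_Gram:
  fixes X :: "real^'d^'n"
  shows "u \<bullet> ((transpose X ** X) *v u) = (norm (X *v u))\<^sup>2"
  by (simp add: matrix_vector_mul_assoc[symmetric] inner_matrix_vector_transpose power2_norm_eq_inner
      del: transpose_matrix_vector)

lemma invertible_Gram:
  fixes X :: "real^'d^'n"
  assumes "rank X = CARD('d)"
  shows "invertible (transpose X ** X)"
proof -
  have inj: "inj ((*v) X)"
    using assms by (simp add: full_rank_injective)
  have "u = 0" if "(transpose X ** X) *v u = 0" for u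
  proof -
    have "X *v u = 0"
      using norm_matrix_vector_Gram[of u X] that by simp
    then show ?thesis
      using inj by (metis injD matrix_vector_mult_0_right)
  qed
  then show ?thesis
    by (simp add: invertible_left_inverse matrix_left_invertible_ker)
qed

lemma hat_matrix_mult: "hat_matrix X *v u = X *v ls_coeff X u"
  by (simp add: hat_matrix_def ls_coeff_def matrix_vector_mul_assoc matrix_mul_assoc)

lemma residual_matrix_mult: "residual_matrix X *v u = u - hat_matrix X *v u"
  by (simp add: residual_matrix_def matrix_vector_mult_diff_rdistrib)

lemma ls_coeff_mult:
  assumes "rank (X :: real^'d^'n) = CARD('d)"
  shows "ls_coeff X (X *v b) = b"
  by (simp add: ls_coeff_def matrix_vector_mul_assoc matrix_mul_assoc[symmetric]
      matrix_inv_mult(2)[OF invertible_Gram[OF assms]])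

lemma transpose_hat_residual:
  assumes "rank (X :: real^'d^'n) = CARD('d)"
  shows "transpose X *v (residual_matrix X *v u) = 0"
proof -
  have "transpose X *v (hat_matrix X *v u) = transpose X *v u"
    by (simp add: hat_matrix_def matrix_vector_mul_assoc matrix_mul_assoc
      matrix_inv_mult(1)[OF invertible_Gram[OF assms]])
  then show ?thesis
    by (simp add: residual_matrix_mult matrix_vector_mult_diff_distrib)
qed

text \<open>\<open>hat_matrix X *v u\<close> lies in the column space of \<open>X\<close>, to which
  every residual is orthogonal.\<close>

lemma hat_residual_orthogonal:
  assumes "rank (X :: real^'d^'n) = CARD('d)"
  shows "(hat_matrix X *v u) \<bullet> (residual_matrix X *v w) = 0"
  unfolding hat_matrix_mult
  by (metis assms inner_commute inner_matrix_vector_transpose inner_zero_left transpose_hat_residual)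

lemma inner_residual:
  assumes "rank (X :: real^'d^'n) = CARD('d)"
  shows "(residual_matrix X *v u) \<bullet> (residual_matrix X *v w)
    = u \<bullet> w - (hat_matrix X *v u) \<bullet> (hat_matrix X *v w)"
    "(residual_matrix X *v u) \<bullet> (residual_matrix X *v w) = (residual_matrix X *v u) \<bullet> w"
  using hat_residual_orthogonal[OF assms, of u w] hat_residual_orthogonal[OF assms, of w u]
  by (simp_all add: residual_matrix_mult inner_diff_left inner_diff_right inner_commute)

lemma norm_residual_le:
  assumes "rank (X :: real^'d^'n) = CARD('d)"
  shows "norm (residual_matrix X *v u) \<le> norm u"
  using inner_residual(1)[OF assms, of u u] by (simp add: norm_le)

section \<open>Eigenvalues of symmetric matrices\<close>

text \<open>\<open>lambda_min\<close> is a \<open>Min\<close>, so bounds on it call for a finite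
  set. Eigenvectors of distinct eigenvalues of a symmetric matrix are orthogonal, and a pairwise
  orthogonal set is finite.\<close>

lemma finite_eigenvalues_symmetric:
  fixes A :: "real^'n^'n"
  assumes sym: "transpose A = A"
  shows "finite {l. \<exists>v. v \<noteq> 0 \<and> A *v v = l *\<^sub>R v}"
proof -
  let ?E = "{l. \<exists>v. v \<noteq> 0 \<and> A *v v = l *\<^sub>R v}"
  obtain e where e: "\<And>l. l \<in> ?E \<Longrightarrow> e l \<noteq> 0 \<and> A *v e l = l *\<^sub>R e l"
    by atomize_elim (auto intro!: choice)
  have orth: "e l \<bullet> e l' = 0" if "l \<in> ?E" "l' \<in> ?E" "l \<noteq> l'" for l l'
  proof -
    have "l' * (e l \<bullet> e l') = e l \<bullet> (A *v e l')"
      using e[OF that(2)] by simp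
    also have "\<dots> = (A *v e l) \<bullet> e l'"
      by (simp add: inner_matrix_vector_transpose sym)
    also have "\<dots> = l * (e l \<bullet> e l')"
      using e[OF that(1)] by simp
    finally show ?thesis using that(3) by simp
  qed
  have "inj_on e ?E"
    by (intro inj_onI) (metis (no_types, lifting) e inner_eq_zero_iff orth)
  moreover have "finite (e ` ?E)"
    by (rule pairwise_orthogonal_imp_finite)
      (auto simp: pairwise_def orthogonal_def intro!: orth)
  ultimately show ?thesis
    by (rule finite_imageD[rotated])
qed

text \<open>The minimum \<open>m\<close> of the quadratic form over the unit sphere is attained, and
  the minimiser is an eigenvector, so \<open>lambda_min A\<close> is at most
  \<open>m\<close>.\<close>

lemma lambda_min_le_Rayleigh:
  fixes A :: "real^'n^'n"
  assumes sym: "transpose A = A"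
  shows "lambda_min A * (norm u)\<^sup>2 \<le> u \<bullet> (A *v u)"
proof -
  let ?S = "sphere (0 :: real^'n) 1" and ?q = "\<lambda>x :: real^'n. x \<bullet> (A *v x)"
  have "?S \<noteq> {}" by simp
  moreover have "continuous_on ?S ?q"
    by (intro continuous_intros matrix_vector_mult_linear_continuous_on)
  ultimately obtain v where v: "norm v = 1" and v_min: "\<And>x. norm x = 1 \<Longrightarrow> ?q v \<le> ?q x"
    using continuous_attains_inf[of ?S ?q] by auto
  define m where "m = ?q v"
  have quot: "m * (norm x)\<^sup>2 \<le> ?q x" for x
  proof (cases "x = 0")
    case False
    have "m \<le> ?q ((1 / norm x) *\<^sub>R x)"
      unfolding m_def by (rule v_min) (use False in simp)
    then show ?thesis
      using False by (simp add: matrix_vector_mult_scaleR field_simps power2_eq_square)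
  qed simp
  \<comment> \<open>\<open>B\<close> is \<open>A - m I\<close>, a positive semidefinite form that
    vanishes at \<open>v\<close>. If \<open>B v\<close> were nonzero, a suitable move from
    \<open>v\<close> along \<open>- B v\<close> would make the form negative.\<close>
  define B where "B x = A *v x - m *\<^sub>R x" for x
  have B_nonneg: "0 \<le> x \<bullet> B x" for x
    using quot[of x] by (simp add: B_def inner_diff_right power2_norm_eq_inner)
  have "B v = 0"
  proof (rule ccontr)
    assume "B v \<noteq> 0"
    define s where "s = B v \<bullet> B v"
    define c where "c = B v \<bullet> B (B v)"
    \<comment> \<open>The quadratic \<open>2 * t * s + t^2 * c\<close> has its minimum at
      \<open>- s / c\<close>; the denominator \<open>c + 1\<close> covers \<open>c = 0\<close> as
      well and still gives a negative value.\<close>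
    define t where "t = - s / (c + 1)"
    have s: "0 < s" using \<open>B v \<noteq> 0\<close> by (simp add: s_def)
    have c: "0 \<le> c" by (simp add: c_def B_nonneg)
    have vBv: "v \<bullet> B v = 0"
      using v by (simp add: B_def m_def inner_diff_right dot_square_norm)
    have vBBv: "v \<bullet> B (B v) = s"
    proof -
      have "v \<bullet> B (B v) = v \<bullet> (A *v B v) - m * (v \<bullet> B v)"
        by (simp add: B_def[of "B v"] inner_diff_right)
      also have "v \<bullet> (A *v B v) = (A *v v) \<bullet> B v"
        by (simp add: inner_matrix_vector_transpose[of v A] sym del: transpose_matrix_vector)
      also have "A *v v = B v + m *\<^sub>R v"
        by (simp add: B_def)
      finally show ?thesis
        by (simp add: inner_add_left s_def)
    qed
    have "B (v + t *\<^sub>R B v) = B v + t *\<^sub>R B (B v)"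
      by (simp add: B_def matrix_vector_right_distrib matrix_vector_mult_scaleR algebra_simps)
    then have "(v + t *\<^sub>R B v) \<bullet> B (v + t *\<^sub>R B v) = 2 * t * s + t\<^sup>2 * c"
      by (simp add: inner_add_left inner_add_right vBv vBBv flip: s_def c_def)
        (simp add: power2_eq_square algebra_simps)
    then have "0 \<le> 2 * t * s + t\<^sup>2 * c"
      using B_nonneg by metis
    moreover have "2 * t * s + t\<^sup>2 * c = - (s\<^sup>2 * (c + 2)) / (c + 1)\<^sup>2"
      using c unfolding t_def by (simp add: divide_simps) (simp add: algebra_simps power2_eq_square)
    moreover have "0 < s\<^sup>2 * (c + 2) / (c + 1)\<^sup>2"
      using s c by simp
    ultimately show False by simp
  qed
  then have "m \<in> {l. \<exists>v. v \<noteq> 0 \<and> A *v v = l *\<^sub>R v}"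
    using v by (intro CollectI exI[of _ v]) (auto simp: B_def)
  then have "lambda_min A \<le> m"
    unfolding lambda_min_def by (intro Min_le finite_eigenvalues_symmetric[OF sym])
  then show ?thesis
    using quot[of u] by (meson mult_right_mono order_trans zero_le_power2)
qed

text \<open>Since \<open>hat_matrix X *v u = X *v ls_coeff X u\<close>, the right side is the Gram
  form at the coefficient vector, and the Rayleigh bound for the scaled Gram matrix applies.\<close>

lemma norm_ls_coeff_le:
  fixes X :: "real^'d^'n"
  assumes "0 < s" "\<gamma> \<le> lambda_min ((1 / s) *\<^sub>R (transpose X ** X))"
  shows "s * \<gamma> * (norm (ls_coeff X u))\<^sup>2 \<le> (norm (hat_matrix X *v u))\<^sup>2"
proof -
  let ?A = "(1 / s) *\<^sub>R (transpose X ** X)"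
  have "transpose ?A = ?A"
    by (simp add: transpose_scalar matrix_transpose_mul)
  from lambda_min_le_Rayleigh[OF this, of "ls_coeff X u"]
  have "lambda_min ?A * (norm (ls_coeff X u))\<^sup>2 \<le> (norm (hat_matrix X *v u))\<^sup>2 / s"
    by (simp add: hat_matrix_mult norm_matrix_vector_Gram flip: scaleR_matrix_vector_assoc)
  moreover have "\<gamma> * (norm (ls_coeff X u))\<^sup>2 \<le> lambda_min ?A * (norm (ls_coeff X u))\<^sup>2"
    using assms(2) by (simp add: mult_right_mono)
  ultimately have "\<gamma> * (norm (ls_coeff X u))\<^sup>2 \<le> (norm (hat_matrix X *v u))\<^sup>2 / s"
    by (rule order_trans[rotated])
  then show ?thesis
    using assms(1) by (simp add: field_simps)
qed

section \<open>Objective and local search\<close>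

lemma infnorm_attained_cart:
  fixes u :: "real^'n"
  obtains i where "infnorm u = \<bar>u $ i\<bar>"
proof -
  have "infnorm u = Max (range (\<lambda>i. \<bar>u $ i\<bar>))"
    by (simp add: infnorm_cart full_SetCompr_eq cSup_eq_Max)
  moreover have "Max (range (\<lambda>i. \<bar>u $ i\<bar>)) \<in> range (\<lambda>i. \<bar>u $ i\<bar>)"
    by (rule Max_in) auto
  ultimately show ?thesis using that by (metis imageE)
qed

lemma inner_supp:
  fixes u w :: "real^'n"
  assumes "\<And>i. i \<notin> S \<Longrightarrow> w $ i = 0"
  shows "u \<bullet> w = (\<Sum>i\<in>S. u $ i * w $ i)"
  unfolding inner_vec_def inner_real_def
  by (rule sum.mono_neutral_right) (use assms in auto)

lemma norm_square_supp:
  fixes u :: "real^'n"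
  assumes "\<And>i. i \<notin> S \<Longrightarrow> u $ i = 0"
  shows "(norm u)\<^sup>2 = (\<Sum>i\<in>S. (u $ i)\<^sup>2)"
  using inner_supp[of S u u] assms by (simp add: power2_norm_eq_inner flip: power2_eq_square)

lemma norm_square_le_card_supp:
  fixes u :: "real^'n"
  assumes "\<And>i. i \<notin> S \<Longrightarrow> u $ i = 0" "\<And>i. i \<in> S \<Longrightarrow> \<bar>u $ i\<bar> \<le> m"
  shows "(norm u)\<^sup>2 \<le> real (card S) * m\<^sup>2"
proof -
  have "(norm u)\<^sup>2 = (\<Sum>i\<in>S. (u $ i)\<^sup>2)"
    using assms(1) by (rule norm_square_supp)
  also have "\<dots> \<le> (\<Sum>i\<in>S. m\<^sup>2)"
    using assms(2) by (intro sum_mono) (metis abs_ge_zero power2_abs power_mono)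
  finally show ?thesis by simp
qed

lemma abs_inner_le_infnorm_supp:
  fixes u w :: "real^'n"
  assumes "\<And>i. i \<notin> S \<Longrightarrow> w $ i = 0"
  shows "\<bar>u \<bullet> w\<bar> \<le> infnorm u * (\<Sum>i\<in>S. \<bar>w $ i\<bar>)"
proof -
  have "\<bar>u \<bullet> w\<bar> \<le> (\<Sum>i\<in>S. \<bar>u $ i * w $ i\<bar>)"
    using sum_abs inner_supp[OF assms] by metis
  also have "\<dots> \<le> (\<Sum>i\<in>S. infnorm u * \<bar>w $ i\<bar>)"
    by (intro sum_mono) (simp add: abs_mult component_le_infnorm_cart mult_right_mono)
  finally show ?thesis by (simp add: sum_distrib_left)
qed

section \<open>Regression setting and error vector\<close>

text \<open>The consequences of (A1) to (A4) that govern the search. \<open>L < U\<close> turns the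
  bound on \<open>R * \<rho>\<close> into \<open>1 / 90\<close> and, with the \<open>1 / 2\<close>
  of the minimum in (A4), the noise bound into \<open>160 * \<sigma>b \<le> L\<close>;
  \<open>C\<^sub>1 > 1\<close> becomes a lower bound on \<open>R\<close>.\<close>

locale mismatched_regression =
  fixes X :: "real^'d^'n" and y \<epsilon> :: "real^'n" and \<beta>s :: "real^'d" and Ps :: "real^'n^'n"
    and R U L \<rho> \<sigma>b :: real and r :: nat
  assumes full_rank: "rank X = CARD('d)"
    and Ps: "Ps \<in> perm_matrices"
    and model: "Ps *v y = X *v \<beta>s + \<epsilon>"
    and dist_Ps: "perm_dist Ps (mat 1) \<le> r"
    and L_pos: "0 < L"
    and L_less_U: "L < U"
    and range_y: "\<And>i j. \<bar>y $ i - y $ j\<bar> \<le> U"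
    and separation: "\<And>i. i \<in> perm_supp Ps \<Longrightarrow> L \<le> \<bar>(Ps *v y) $ i - y $ i\<bar>"
    and R_lower: "10 * real r * U\<^sup>2 / L\<^sup>2 + 4 \<le> R"
    and R_\<rho>: "R * \<rho> \<le> 1 / 90"
    and hat_sparse_4: "\<And>u. u \<in> sparse_vectors 4 \<Longrightarrow> (norm (hat_matrix X *v u))\<^sup>2 \<le> \<rho> * (norm u)\<^sup>2"
    and hat_sparse_2R:
      "\<And>u. u \<in> sparse_vectors (2 * R) \<Longrightarrow> (norm (hat_matrix X *v u))\<^sup>2 \<le> R * \<rho> * (norm u)\<^sup>2"
    and \<sigma>b_nonneg: "0 \<le> \<sigma>b"
    and \<sigma>b_le: "160 * \<sigma>b \<le> L"
    and residual_noise: "infnorm (residual_matrix X *v \<epsilon>) \<le> \<sigma>b"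
begin

text \<open>The vector \<open>v\<close> of the overview; it vanishes wherever \<open>Q\<close> and
  \<open>Ps\<close> agree.\<close>

definition err :: "real^'n^'n \<Rightarrow> real^'n" where
  "err Q = Q *v y - Ps *v y"

lemma r_L_U: "10 * (real r * U\<^sup>2) \<le> (R - 4) * L\<^sup>2"
  using R_lower L_pos by (simp add: field_simps)

lemma R_ge: "4 \<le> R" "10 * real r + 4 \<le> R"
proof -
  have "0 \<le> 10 * real r * U\<^sup>2 / L\<^sup>2" by simp
  then show "4 \<le> R" using R_lower by linarith
  have "10 * real r * 1 \<le> 10 * real r * (U\<^sup>2 / L\<^sup>2)"
    using L_pos L_less_U by (intro mult_left_mono) (auto simp: power_mono)
  then show "10 * real r + 4 \<le> R" using R_lower by simp
qed

text \<open>A unit vector is 4-sparse with norm 1, so its bound by \<open>\<rho>\<close> forces the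
  sign.\<close>

lemma \<rho>_nonneg: "0 \<le> \<rho>"
proof -
  fix i :: 'n
  have "{k. axis i (1::real) $ k \<noteq> 0} = {i}"
    by (auto simp: axis_def)
  then have "axis i 1 \<in> sparse_vectors 4"
    by (simp add: sparse_vectors_def)
  from hat_sparse_4[OF this] show ?thesis
    by (simp add: norm_axis_1) (meson order_trans zero_le_power2)
qed

lemma \<rho>_le: "\<rho> \<le> 1 / 360"
  using mult_right_mono[OF R_ge(1) \<rho>_nonneg] R_\<rho> by linarith

lemma err_nth:
  assumes "Q \<in> perm_matrices"
  shows "err Q $ i = y $ perm_of Q i - y $ perm_of Ps i"
  by (simp add: err_def perm_matrix_mult_nth[OF assms] perm_matrix_mult_nth[OF Ps])

lemma err_eq_0:
  assumes "Q \<in> perm_matrices" "perm_of Q i = perm_of Ps i"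
  shows "err Q $ i = 0"
  using assms by (simp add: err_nth)

text \<open>\<open>r \<le> R\<close>, and the detour through the identity costs at most
  \<open>R + r\<close>. This makes \<open>err Q\<close> sparse enough for
  \<open>hat_sparse_2R\<close>.\<close>

lemma perm_dist_Ps_le:
  assumes "real (perm_dist Q (mat 1)) \<le> R"
  shows "real (perm_dist Q Ps) \<le> 2 * R"
proof -
  have "real (perm_dist Q Ps) \<le> real (perm_dist Q (mat 1)) + real r"
    using perm_dist_triangle[of Q Ps "mat 1"] dist_Ps perm_dist_commute[of Ps "mat 1"] by linarith
  then show ?thesis using assms R_ge(2) by linarith
qed

lemma norm_err_le:
  assumes "Q \<in> perm_matrices" "real (perm_dist Q (mat 1)) \<le> R"
  shows "(norm (err Q))\<^sup>2 \<le> 2 * R * (infnorm (err Q))\<^sup>2"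
proof -
  have "(norm (err Q))\<^sup>2 \<le> real (perm_dist Q Ps) * (infnorm (err Q))\<^sup>2"
    unfolding perm_dist_def
    by (rule norm_square_le_card_supp) (auto intro: err_eq_0 assms simp: component_le_infnorm_cart)
  also have "\<dots> \<le> 2 * R * (infnorm (err Q))\<^sup>2"
    by (intro mult_right_mono perm_dist_Ps_le assms) auto
  finally show ?thesis .
qed

lemma hat_err_le:
  assumes "Q \<in> perm_matrices" "real (perm_dist Q (mat 1)) \<le> R"
  shows "(norm (hat_matrix X *v err Q))\<^sup>2 \<le> R * \<rho> * (norm (err Q))\<^sup>2"
proof (rule hat_sparse_2R)
  have "card {i. err Q $ i \<noteq> 0} \<le> perm_dist Q Ps"
    unfolding perm_dist_def by (rule card_mono) (auto dest: err_eq_0[OF assms(1)])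
  then show "err Q \<in> sparse_vectors (2 * R)"
    using perm_dist_Ps_le[OF assms(2)] by (simp add: sparse_vectors_def)
qed

text \<open>The residual matrix annihilates \<open>X *v \<beta>s\<close>, so the objective sees only
  the error and the noise.\<close>

lemma residual_mult: "residual_matrix X *v (Q *v y) = residual_matrix X *v (err Q + \<epsilon>)"
proof -
  have "residual_matrix X *v (X *v \<beta>s) = 0"
    by (simp add: residual_matrix_mult hat_matrix_mult ls_coeff_mult[OF full_rank])
  moreover have "Q *v y = X *v \<beta>s + (err Q + \<epsilon>)"
    using model by (simp add: err_def)
  ultimately show ?thesis
    by (simp add: matrix_vector_right_distrib)
qed

section \<open>Objective relative to the true permutation\<close>

lemma objective_eq:
  "objective X y Q = (norm (residual_matrix X *v (err Q + \<epsilon>)))\<^sup>2"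
  by (simp add: objective_def residual_mult)

lemma objective_diff_Ps:
  "objective X y Q - objective X y Ps
    = (norm (err Q))\<^sup>2 - (norm (hat_matrix X *v err Q))\<^sup>2 + 2 * ((residual_matrix X *v \<epsilon>) \<bullet> err Q)"
proof -
  have "err Ps = 0" by (simp add: err_def)
  then show ?thesis
    using inner_residual(1)[OF full_rank, of "err Q" "err Q"] inner_residual(2)[OF full_rank, of \<epsilon> "err Q"]
    by (simp add: objective_eq matrix_vector_right_distrib power2_norm_eq_inner inner_add_left
        inner_add_right inner_commute)
qed

text \<open>Once the hat term has taken \<open>1 / 90\<close> of the square, each of the at most
  \<open>2 * R\<close> places of disagreement contributes at least
  \<open>- 2 * \<sigma>b^2\<close>.\<close>

lemma objective_diff_ge:
  assumes "Q \<in> perm_matrices" "real (perm_dist Q (mat 1)) \<le> R"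
  shows "- (4 * R * \<sigma>b\<^sup>2) \<le> objective X y Q - objective X y Ps"
proof -
  let ?S = "{i. perm_of Q i \<noteq> perm_of Ps i}" and ?v = "err Q"
  have supp: "?v $ i = 0" if "i \<notin> ?S" for i
    using that err_eq_0[OF assms(1)] by blast
  have norm_v: "(norm ?v)\<^sup>2 = (\<Sum>i\<in>?S. (?v $ i)\<^sup>2)"
    using supp by (rule norm_square_supp)
  have "(norm (hat_matrix X *v ?v))\<^sup>2 \<le> 1 / 90 * (norm ?v)\<^sup>2"
    using hat_err_le[OF assms] mult_right_mono[OF R_\<rho>, of "(norm ?v)\<^sup>2"] by auto
  moreover have "\<bar>(residual_matrix X *v \<epsilon>) \<bullet> ?v\<bar> \<le> \<sigma>b * (\<Sum>i\<in>?S. \<bar>?v $ i\<bar>)"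
    by (rule order_trans[OF abs_inner_le_infnorm_supp[of ?S, OF supp]])
      (auto intro: mult_right_mono residual_noise sum_nonneg)
  ultimately have "89 / 90 * (\<Sum>i\<in>?S. (?v $ i)\<^sup>2) - 2 * (\<sigma>b * (\<Sum>i\<in>?S. \<bar>?v $ i\<bar>))
      \<le> objective X y Q - objective X y Ps"
    unfolding objective_diff_Ps norm_v by linarith
  moreover have "(\<Sum>i\<in>?S. - 2 * \<sigma>b\<^sup>2)
      \<le> (\<Sum>i\<in>?S. 89 / 90 * (?v $ i)\<^sup>2 - 2 * (\<sigma>b * \<bar>?v $ i\<bar>))"
  proof (rule sum_mono)
    fix i
    \<comment> \<open>Completing the square: half of the quadratic term absorbs the noise term up to
      \<open>2 * \<sigma>b^2\<close>, and the remaining \<open>89/90 - 1/2\<close> is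
      nonnegative.\<close>
    have "0 \<le> 1/2 * (\<bar>?v $ i\<bar> - 2 * \<sigma>b)\<^sup>2 + (89/90 - 1/2) * (\<bar>?v $ i\<bar>)\<^sup>2" by simp
    then show "- 2 * \<sigma>b\<^sup>2 \<le> 89 / 90 * (?v $ i)\<^sup>2 - 2 * (\<sigma>b * \<bar>?v $ i\<bar>)"
      by (simp add: power2_diff algebra_simps)
  qed
  moreover have "real (card ?S) * \<sigma>b\<^sup>2 \<le> 2 * R * \<sigma>b\<^sup>2"
    using perm_dist_Ps_le[OF assms(2)] by (intro mult_right_mono) (auto simp: perm_dist_def)
  ultimately show ?thesis
    by (simp add: sum_subtractf sum_distrib_left)
qed

text \<open>The identity is wrong in at most \<open>r\<close> places, each by at most
  \<open>U\<close>. The summand \<open>1 / 80\<close> is the noise term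
  \<open>2 * \<sigma>b * r * U\<close>, as \<open>\<sigma>b \<le> U / 160\<close>.\<close>

lemma objective_diff_initial:
  "objective X y (mat 1) - objective X y Ps \<le> real r * U\<^sup>2 * (1 + 1 / 80)"
proof -
  let ?S = "{i. perm_of (mat 1) i \<noteq> perm_of Ps i}" and ?v = "err (mat 1)"
  have card: "real (card ?S) \<le> real r"
    using dist_Ps perm_dist_commute[of Ps "mat 1"] by (simp add: perm_dist_def)
  have supp: "?v $ i = 0" if "i \<notin> ?S" for i
    using that err_eq_0[OF mat_1_perm_matrix] by blast
  have v_le: "\<bar>?v $ i\<bar> \<le> U" for i
    using range_y by (simp add: err_nth[OF mat_1_perm_matrix])
  have "(norm ?v)\<^sup>2 \<le> real (card ?S) * U\<^sup>2"
    by (rule norm_square_le_card_supp) (use supp v_le in auto)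
  also have "\<dots> \<le> real r * U\<^sup>2"
    using card by (intro mult_right_mono) auto
  finally have *: "(norm ?v)\<^sup>2 \<le> real r * U\<^sup>2" .
  have "(\<Sum>i\<in>?S. \<bar>?v $ i\<bar>) \<le> real (card ?S) * U"
    using sum_bounded_above[of ?S "\<lambda>i. \<bar>?v $ i\<bar>" U] v_le by simp
  also have "\<dots> \<le> real r * U"
    using card L_pos L_less_U by (intro mult_right_mono) auto
  finally have "\<sigma>b * (\<Sum>i\<in>?S. \<bar>?v $ i\<bar>) \<le> (U / 160) * (real r * U)"
    using \<sigma>b_nonneg \<sigma>b_le L_pos L_less_U by (intro mult_mono) (auto intro: sum_nonneg)
  moreover have "(residual_matrix X *v \<epsilon>) \<bullet> ?v \<le> \<sigma>b * (\<Sum>i\<in>?S. \<bar>?v $ i\<bar>)"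
    by (rule order_trans[OF order_trans[OF abs_ge_self abs_inner_le_infnorm_supp[of ?S, OF supp]]])
      (auto intro: mult_right_mono residual_noise sum_nonneg)
  ultimately have **: "2 * ((residual_matrix X *v \<epsilon>) \<bullet> ?v) \<le> real r * U\<^sup>2 * (1 / 80)"
    by (simp add: power2_eq_square algebra_simps)
  have "0 \<le> (norm (hat_matrix X *v ?v))\<^sup>2" by simp
  with * ** show ?thesis
    unfolding objective_diff_Ps distrib_left by linarith
qed

section \<open>Gain of a single exchange\<close>

text \<open>The exchange subtracts \<open>w = A (e_i - e_j)\<close> from the error and lowers its
  squared norm by exactly \<open>- 2 * (A * Z)\<close>. As for the rest, the noise costs
  \<open>4 * \<sigma>b * |A|\<close>, the mixed hat term at most \<open>2 / 45\<close>, rounded up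
  to \<open>1 / 20\<close>, of \<open>m * |A|\<close>, and the hat term of \<open>w\<close> lies
  between \<open>0\<close> and \<open>A^2 / 180\<close>, so it enters the upper bound only.\<close>

lemma swap_objective:
  assumes Q: "Q \<in> perm_matrices" "real (perm_dist Q (mat 1)) \<le> R" and Q': "Q' \<in> perm_matrices"
    and ij: "i \<noteq> j" and swap: "perm_of Q' = perm_of Q \<circ> Transposition.transpose i j"
  defines "A \<equiv> y $ perm_of Q i - y $ perm_of Q j" and "Z \<equiv> y $ perm_of Ps i - y $ perm_of Ps j"
  defines "m \<equiv> infnorm (err Q)"
  shows "- 2 * (A * Z) - \<bar>A\<bar> * (4 * \<sigma>b + m / 20) \<le> objective X y Q - objective X y Q'"
    and "objective X y Q - objective X y Q' \<le> - 2 * (A * Z) + \<bar>A\<bar> * (4 * \<sigma>b + m / 20) + A\<^sup>2 / 180"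
proof -
  define w where "w = err Q - err Q'"
  have w_nth: "w $ k = (if k = i then A else if k = j then - A else 0)" for k
    using ij by (simp add: w_def err_nth Q Q' swap A_def Transposition.transpose_def)
  have w_out: "w $ k = 0" if "k \<notin> {i, j}" for k
    using that by (simp add: w_nth)
  have inner_w: "u \<bullet> w = A * (u $ i - u $ j)" for u
  proof -
    have "u \<bullet> w = (\<Sum>k\<in>{i, j}. u $ k * w $ k)"
      using w_out by (rule inner_supp)
    then show ?thesis using ij by (simp add: w_nth algebra_simps)
  qed
  have norm_w: "(norm w)\<^sup>2 = 2 * A\<^sup>2"
    using inner_w[of w] ij by (simp add: w_nth power2_norm_eq_inner power2_eq_square[of A])
  have "card {k. w $ k \<noteq> 0} \<le> card {i, j}"
    by (rule card_mono) (use w_out in auto)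
  then have "w \<in> sparse_vectors 4"
    using ij by (simp add: sparse_vectors_def)
  then have Hw: "(norm (hat_matrix X *v w))\<^sup>2 \<le> \<rho> * (2 * A\<^sup>2)"
    using hat_sparse_4 norm_w by metis
  also have "\<dots> \<le> 1 / 360 * (2 * A\<^sup>2)"
    using \<rho>_le by (intro mult_right_mono) auto
  finally have Hw': "(norm (hat_matrix X *v w))\<^sup>2 \<le> A\<^sup>2 / 180" by simp
  let ?c = "(hat_matrix X *v err Q) \<bullet> (hat_matrix X *v w)"
  have "\<bar>?c\<bar>\<^sup>2 \<le> (norm (hat_matrix X *v err Q))\<^sup>2 * (norm (hat_matrix X *v w))\<^sup>2"
    using Cauchy_Schwarz_ineq2[of "hat_matrix X *v err Q" "hat_matrix X *v w"]
    by (metis abs_ge_zero power_mono power_mult_distrib)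
  \<comment> \<open>The error contributes \<open>R * \<rho>\<close> times a norm over up to
    \<open>2 * R\<close> coordinates, the 4-sparse \<open>w\<close> only \<open>\<rho>\<close>. The
    root of the product thus has the factor \<open>R * \<rho>\<close>, which is at most
    \<open>1 / 90\<close>.\<close>
  also have "\<dots> \<le> (R * \<rho> * (2 * R * m\<^sup>2)) * (\<rho> * (2 * A\<^sup>2))"
  proof (rule mult_mono)
    show "(norm (hat_matrix X *v err Q))\<^sup>2 \<le> R * \<rho> * (2 * R * m\<^sup>2)"
      using hat_err_le[OF Q] norm_err_le[OF Q] R_ge(1) \<rho>_nonneg unfolding m_def
      by (meson mult_left_mono mult_nonneg_nonneg order_trans zero_le_numeral)
  qed (use Hw R_ge(1) \<rho>_nonneg in auto)
  also have "\<dots> = (R * \<rho> * (2 * m * \<bar>A\<bar>))\<^sup>2"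
    by (simp add: power2_eq_square)
  finally have "\<bar>?c\<bar> \<le> R * \<rho> * (2 * m * \<bar>A\<bar>)"
    by (rule power2_le_imp_le) (use R_ge(1) \<rho>_nonneg in \<open>auto simp: m_def infnorm_pos_le\<close>)
  also have "\<dots> \<le> 1 / 90 * (2 * m * \<bar>A\<bar>)"
    using R_\<rho> by (intro mult_right_mono) (auto simp: m_def infnorm_pos_le)
  finally have cross: "\<bar>?c\<bar> \<le> \<bar>A\<bar> * m / 45" by (simp add: mult.commute)
  have "0 \<le> \<bar>A\<bar> * m" by (simp add: m_def infnorm_pos_le)
  with cross have cross': "2 * \<bar>?c\<bar> \<le> \<bar>A\<bar> * (m / 20)" by simp
  let ?n = "(residual_matrix X *v \<epsilon>) \<bullet> w"
  have "\<bar>?n\<bar> \<le> infnorm (residual_matrix X *v \<epsilon>) * (\<Sum>k\<in>{i, j}. \<bar>w $ k\<bar>)"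
    by (rule abs_inner_le_infnorm_supp[OF w_out])
  also have "\<dots> \<le> \<sigma>b * (2 * \<bar>A\<bar>)"
    using ij residual_noise by (simp add: w_nth mult_right_mono)
  finally have noise: "2 * \<bar>?n\<bar> \<le> \<bar>A\<bar> * (4 * \<sigma>b)" by simp
  have err': "err Q' = err Q - w" by (simp add: w_def)
  \<comment> \<open>\<open>err Q $ i - err Q $ j = A - Z\<close>, so the left side is
    \<open>2 * A * (A - Z) - 2 * A^2\<close>.\<close>
  have main: "2 * (err Q \<bullet> w) - w \<bullet> w = - 2 * (A * Z)"
    using ij by (simp add: inner_w w_nth err_nth[OF Q(1)])
      (simp add: A_def Z_def algebra_simps)
  have "objective X y Q - objective X y Q'
      = 2 * ((residual_matrix X *v err Q) \<bullet> (residual_matrix X *v w))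
        + 2 * ((residual_matrix X *v \<epsilon>) \<bullet> (residual_matrix X *v w))
        - (residual_matrix X *v w) \<bullet> (residual_matrix X *v w)"
    by (simp add: objective_eq err' matrix_vector_right_distrib matrix_vector_mult_diff_distrib
        power2_norm_eq_inner inner_add_left inner_add_right inner_diff_left inner_diff_right
        inner_commute algebra_simps)
  also have "\<dots> = - 2 * (A * Z) - 2 * ?c + 2 * ?n + (norm (hat_matrix X *v w))\<^sup>2"
    unfolding inner_residual(1)[OF full_rank, of "err Q"] inner_residual(1)[OF full_rank, of w]
      inner_residual(2)[OF full_rank, of \<epsilon>] power2_norm_eq_inner main[symmetric]
    by simp
  finally have eq: "objective X y Q - objective X y Q'
    = - 2 * (A * Z) - 2 * ?c + 2 * ?n + (norm (hat_matrix X *v w))\<^sup>2" .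
  have "0 \<le> (norm (hat_matrix X *v w))\<^sup>2" by simp
  then show "- 2 * (A * Z) - \<bar>A\<bar> * (4 * \<sigma>b + m / 20) \<le> objective X y Q - objective X y Q'"
    unfolding eq distrib_left using cross' noise by linarith
  show "objective X y Q - objective X y Q' \<le> - 2 * (A * Z) + \<bar>A\<bar> * (4 * \<sigma>b + m / 20) + A\<^sup>2 / 180"
    unfolding eq distrib_left using cross' noise Hw' by linarith
qed

text \<open>Exchange a coordinate of maximal error with its crossing partner: \<open>A\<close> and
  \<open>Z\<close> have opposite signs and size at least \<open>m / 2\<close>, so
  \<open>- 2 * (A * Z)\<close> is at least \<open>|A| * m\<close>, against a perturbation of
  \<open>|A| * (4 * \<sigma>b + m / 20)\<close>. The assumption \<open>room\<close> keeps the result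
  within distance \<open>R\<close> of the identity.\<close>

lemma greedy_swap:
  assumes Q: "Q \<in> perm_matrices" "real (perm_dist Q (mat 1)) \<le> R"
    and room: "real (perm_dist Q (mat 1)) + 2 \<le> R \<or> perm_supp Ps \<subseteq> perm_supp Q"
  defines "m \<equiv> infnorm (err Q)"
  obtains Q' where "Q' \<in> search_nbhd R Q"
    "m / 2 * (19 / 20 * m - 4 * \<sigma>b) \<le> objective X y Q - objective X y Q'"
proof (cases "19 / 20 * m - 4 * \<sigma>b \<le> 0")
  case True
  \<comment> \<open>When the claimed gain is not positive, staying at \<open>Q\<close>
    suffices.\<close>
  have "Q \<in> search_nbhd R Q"
    using Q by (simp add: search_nbhd_def)
  moreover have "m / 2 * (19 / 20 * m - 4 * \<sigma>b) \<le> 0"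
    using True by (simp add: m_def infnorm_pos_le mult_nonneg_nonpos)
  ultimately show ?thesis using that by auto
next
  case False
  then have pos: "0 < 19 / 20 * m - 4 * \<sigma>b" by simp
  let ?p = "perm_of Ps" and ?q = "perm_of Q"
  define a z where "a = (\<lambda>i. y $ ?q i)" and "z = (\<lambda>i. y $ ?p i)"
  note q = bij_perm_of[OF Q(1)] and p = bij_perm_of[OF Ps]
  obtain i where "m = \<bar>err Q $ i\<bar>"
    unfolding m_def by (rule infnorm_attained_cart)
  then have m: "m = \<bar>a i - z i\<bar>"
    by (simp add: err_nth[OF Q(1)] a_def z_def)
  have "m > 0" using pos \<sigma>b_nonneg by linarith
  then have "a i \<noteq> z i" using m by auto
  moreover have "bij (inv ?p \<circ> ?q)"
    using p q by (simp add: bij_comp bij_imp_bij_inv)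
  moreover have "a = z \<circ> (inv ?p \<circ> ?q)"
    using p by (simp add: a_def z_def fun_eq_iff bij_is_surj surj_f_inv_f)
  ultimately obtain j where j: "j \<noteq> i" "a j \<noteq> z j" "(a i - a j) * (z i - z j) \<le> 0"
    "m / 2 \<le> \<bar>a i - a j\<bar>" "m / 2 \<le> \<bar>z i - z j\<bar>"
    unfolding m by (metis crossing_swap)
  define q' where "q' = ?q \<circ> Transposition.transpose i j"
  have q': "bij q'"
    unfolding q'_def using q by (simp add: bij_comp)
  define Q' where "Q' = matrix_of_perm q'"
  have Q': "Q' \<in> perm_matrices" "perm_of Q' = q'"
    using q' by (simp_all add: Q'_def matrix_of_perm_in)
  have out: "q' k = ?q k" if "k \<noteq> i" "k \<noteq> j" for k
    using that by (simp add: q'_def)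
  have "perm_dist Q' Q \<le> card {i, j}"
    unfolding perm_dist_def Q' by (rule card_mono) (use out in auto)
  then have near: "perm_dist Q' Q \<le> 2" using j(1) by simp
  have "real (perm_dist Q' (mat 1)) \<le> R"
    using room
  proof
    assume "real (perm_dist Q (mat 1)) + 2 \<le> R"
    then show ?thesis
      using perm_dist_triangle[of Q' "mat 1" Q] near by linarith
  next
    assume sub: "perm_supp Ps \<subseteq> perm_supp Q"
    \<comment> \<open>At a point fixed by \<open>Q\<close>, hence by \<open>Ps\<close>, the error
      would vanish. So both exchanged points are in the support already, and it cannot grow.\<close>
    have "i \<in> perm_supp Q" "j \<in> perm_supp Q"
      using sub \<open>a i \<noteq> z i\<close> j(2) by (force simp: perm_supp_def a_def z_def)+
    then have "perm_supp Q' \<subseteq> perm_supp Q"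
      using out unfolding perm_supp_def Q'(2) by (metis (mono_tags, lifting) mem_Collect_eq subsetI)
    then have "perm_dist Q' (mat 1) \<le> perm_dist Q (mat 1)"
      unfolding perm_dist_eq_card_supp by (intro card_mono) auto
    then show ?thesis using Q(2) by linarith
  qed
  then have "Q' \<in> search_nbhd R Q"
    using Q' near by (simp add: search_nbhd_def)
  moreover have "m / 2 * (19 / 20 * m - 4 * \<sigma>b) \<le> objective X y Q - objective X y Q'"
  proof -
    define A Z where "A = a i - a j" and "Z = z i - z j"
    have AZ: "\<bar>A\<bar> * \<bar>Z\<bar> = - (A * Z)"
      using abs_of_nonpos[OF j(3)] by (simp add: A_def Z_def flip: abs_mult)
    have "m / 2 * (19 / 20 * m - 4 * \<sigma>b) \<le> \<bar>A\<bar> * (19 / 20 * m - 4 * \<sigma>b)"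
      using j(4) pos by (intro mult_right_mono) (auto simp: A_def)
    also have "\<dots> \<le> \<bar>A\<bar> * (2 * \<bar>Z\<bar> - (4 * \<sigma>b + m / 20))"
      using j(5) by (intro mult_left_mono) (auto simp: Z_def)
    also have "\<dots> = 2 * (\<bar>A\<bar> * \<bar>Z\<bar>) - \<bar>A\<bar> * (4 * \<sigma>b + m / 20)"
      by (simp add: right_diff_distrib)
    also have "\<dots> = - 2 * (A * Z) - \<bar>A\<bar> * (4 * \<sigma>b + m / 20)"
      unfolding AZ by simp
    also have "\<dots> \<le> objective X y Q - objective X y Q'"
      using swap_objective(1)[OF Q Q'(1) j(1)[symmetric] Q'(2)[unfolded q'_def]]
      by (simp add: A_def Z_def a_def z_def m_def)
    finally show ?thesis .
  qed
  ultimately show ?thesis using that by blast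
qed

section \<open>Errors below the separation level\<close>

text \<open>At a point of \<open>perm_supp Ps\<close> that \<open>Q\<close> fixes, the error is
  \<open>y $ i - (Ps *v y) $ i\<close>, of size at least \<open>L\<close>.\<close>

lemma supp_Ps_subset:
  assumes "Q \<in> perm_matrices" "infnorm (err Q) < L"
  shows "perm_supp Ps \<subseteq> perm_supp Q"
proof
  fix i assume i: "i \<in> perm_supp Ps"
  show "i \<in> perm_supp Q"
  proof (rule ccontr)
    assume "i \<notin> perm_supp Q"
    then have "err Q $ i = y $ i - (Ps *v y) $ i"
      by (simp add: err_nth[OF assms(1)] perm_matrix_mult_nth[OF Ps] perm_supp_def)
    then show False
      using separation[OF i] component_le_infnorm_cart[of "err Q" i] assms(2) by linarith
  qed
qed

text \<open>An objective-improving swap can increase the sup-norm error only if the error is already of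
  noise size: with \<open>A = (Qy)\<^sub>i - (Qy)\<^sub>j\<close> and \<open>Z = (P\<^sup>*y)\<^sub>i - (P\<^sup>*y)\<^sub>j\<close>, the new errors at \<open>i\<close> and \<open>j\<close> have the same
  sum as the old ones while their difference changes from \<open>A - Z\<close> to \<open>- (A + Z)\<close>.\<close>

lemma infnorm_err_step:
  assumes Q: "Q \<in> perm_matrices" "real (perm_dist Q (mat 1)) \<le> R"
    and small: "infnorm (err Q) < L"
    and step: "is_arg_min (objective X y) (\<lambda>Q'. Q' \<in> search_nbhd R Q) Q'"
  shows "infnorm (err Q') < L"
proof -
  define m where "m = infnorm (err Q)"
  have m_nonneg: "0 \<le> m" by (simp add: m_def infnorm_pos_le)
  have Q': "Q' \<in> perm_matrices" "perm_dist Q' Q \<le> 2"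
    using step by (auto simp: is_arg_min_def search_nbhd_def)
  obtain T where T: "T \<in> search_nbhd R Q"
    "m / 2 * (19 / 20 * m - 4 * \<sigma>b) \<le> objective X y Q - objective X y T"
    unfolding m_def using greedy_swap[OF Q disjI2[OF supp_Ps_subset[OF Q(1) small]]] by blast
  have "objective X y Q' \<le> objective X y T"
    using step T(1) by (auto simp: is_arg_min_def not_less)
  \<comment> \<open>The minimiser gains at least as much as the exchange from
    \<open>greedy_swap\<close>.\<close>
  with T(2) have decr: "m / 2 * (19 / 20 * m - 4 * \<sigma>b) \<le> objective X y Q - objective X y Q'"
    by linarith
  have err_le: "\<bar>err Q $ k\<bar> \<le> m" for k
    by (simp add: m_def component_le_infnorm_cart)
  show ?thesis
    using Q'(1) Q(1) Q'(2)
  proof (cases rule: perm_dist_le_2_cases)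
    case 1
    then have "err Q' = err Q"
      using err_nth[OF Q(1)] err_nth[OF Q'(1)] by (simp add: vec_eq_iff)
    then show ?thesis using small by simp
  next
    case (2 i j)
    define A Z where "A = y $ perm_of Q i - y $ perm_of Q j"
      and "Z = y $ perm_of Ps i - y $ perm_of Ps j"
    define s where "s = err Q $ i + err Q $ j"
    have AZ: "err Q $ i - err Q $ j = A - Z" and AZ': "err Q' $ i - err Q' $ j = - (A + Z)"
      and s': "err Q' $ i + err Q' $ j = s"
      by (simp_all add: s_def err_nth Q(1) Q'(1) 2 A_def Z_def)
    have out: "err Q' $ k = err Q $ k" if "k \<noteq> i" "k \<noteq> j" for k
      using that by (simp add: err_nth Q(1) Q'(1) 2)
    obtain k where k: "infnorm (err Q') = \<bar>err Q' $ k\<bar>"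
      by (rule infnorm_attained_cart)
    have le_L: "infnorm (err Q') < L" if i: "\<bar>err Q' $ i\<bar> < L" and j: "\<bar>err Q' $ j\<bar> < L"
    proof -
      consider "k = i" | "k = j" | "k \<noteq> i" "k \<noteq> j" by blast
      then show ?thesis
        by cases (use i j k out err_le[of k] small in \<open>auto simp: m_def\<close>)
    qed
    have AmZ: "\<bar>A - Z\<bar> \<le> 2 * m"
      using err_le[of i] err_le[of j] AZ by linarith
    show ?thesis
    proof (cases "A * Z < 0")
      case True
      \<comment> \<open>The two errors keep their sum while their difference does not grow in size,
        so neither exceeds the old maximum.\<close>
      then have "\<bar>A + Z\<bar> \<le> \<bar>A - Z\<bar>"
        by (auto simp: mult_less_0_iff)
      then have "\<bar>err Q' $ i\<bar> \<le> m" "\<bar>err Q' $ j\<bar> \<le> m"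
        using AZ AZ' s' err_le[of i] err_le[of j] unfolding s_def by linarith+
      then show ?thesis
        using small le_L by (simp add: m_def)
    next
      case False
      define \<alpha> where "\<alpha> = \<bar>A\<bar>"
      have AZ_eq: "A * Z = \<alpha> * \<bar>Z\<bar>"
        using False by (simp add: \<alpha>_def not_less flip: abs_mult)
      have "\<alpha> - 2 * m \<le> \<bar>Z\<bar>"
        using AmZ unfolding \<alpha>_def by linarith
      then have AZ_ge: "\<alpha> * (\<alpha> - 2 * m) \<le> A * Z"
        unfolding AZ_eq by (rule mult_left_mono) (simp add: \<alpha>_def)
      have upper: "objective X y Q - objective X y Q'
          \<le> - 2 * (A * Z) + \<alpha> * (4 * \<sigma>b + m / 20) + \<alpha>\<^sup>2 / 180"
        using swap_objective(2)[OF Q Q'(1) 2] by (simp add: \<alpha>_def A_def Z_def m_def)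
      have \<alpha>_nonneg: "0 \<le> \<alpha>" by (simp add: \<alpha>_def)
      \<comment> \<open>An exchange with \<open>A * Z \<ge> 0\<close> gains only through the
        perturbation, which is too little for \<open>decr\<close> unless \<open>m\<close> is of
        noise size.\<close>
      have m_le: "m \<le> 30 * \<sigma>b"
      proof (rule ccontr)
        assume "\<not> m \<le> 30 * \<sigma>b"
        then have \<sigma>m: "\<sigma>b \<le> m / 30" and m: "0 < m"
          using \<sigma>b_nonneg by linarith+
        have "m * \<sigma>b \<le> m * (m / 30)" "\<alpha> * \<sigma>b \<le> \<alpha> * (m / 30)"
          using \<sigma>m m \<alpha>_nonneg by (intro mult_left_mono; simp)+
        \<comment> \<open>\<open>decr\<close> and \<open>upper\<close> combined and multiplied by
          360, with \<open>\<sigma>b\<close> replaced by \<open>m / 30\<close>.\<close>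
        then have bound: "147 * (m * m) \<le> - 720 * (A * Z) + 66 * (\<alpha> * m) + 2 * (\<alpha> * \<alpha>)"
          using decr upper by (simp add: power2_eq_square algebra_simps)
        have mm: "0 < m * m" using m by simp
        \<comment> \<open>For \<open>\<alpha> \<le> 2 * m\<close> the right side is at most
          \<open>140 * m^2\<close>. Beyond that, the excess \<open>e\<close> makes
          \<open>A * Z\<close> at least \<open>e * (2 * m + e)\<close>, whose factor
          \<open>720\<close> outweighs all terms in \<open>e\<close>.\<close>
        show False
        proof (cases "\<alpha> \<le> 2 * m")
          case True
          then have "\<alpha> * m \<le> 2 * m * m" "\<alpha> * \<alpha> \<le> (2 * m) * (2 * m)"
            using m \<alpha>_nonneg by (intro mult_mono; simp)+
          moreover have "0 \<le> A * Z" using False by simp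
          ultimately show False using bound mm by (simp add: algebra_simps)
        next
          case False
          define e where "e = \<alpha> - 2 * m"
          have \<alpha>: "\<alpha> = 2 * m + e" and e: "0 < e" using False by (simp_all add: e_def)
          have "147 * (m * m) + 720 * (A * Z) \<le> 140 * (m * m) + 74 * (m * e) + 2 * (e * e)"
            using bound by (simp add: \<alpha> algebra_simps)
          moreover have "720 * (2 * (m * e)) + 720 * (e * e) \<le> 720 * (A * Z)"
            using AZ_ge by (simp add: \<alpha> algebra_simps)
          moreover have "0 < m * e" "0 < e * e" using m e by simp_all
          ultimately show False using mm by argo
        qed
      qed
      have "Q \<in> search_nbhd R Q" using Q by (simp add: search_nbhd_def)
      then have "objective X y Q' \<le> objective X y Q"
        using step by (auto simp: is_arg_min_def not_less)
      then have "\<alpha> * (2 * (\<alpha> - 2 * m)) \<le> \<alpha> * (4 * \<sigma>b + m / 20 + \<alpha> / 180)"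
        using upper AZ_ge by (simp add: power2_eq_square algebra_simps)
      \<comment> \<open>Dividing by \<open>\<alpha>\<close> and inserting
        \<open>m \<le> 30 * \<sigma>b\<close> bounds \<open>\<alpha>\<close> by about
        \<open>63 * \<sigma>b\<close>. The new errors are then at most
        \<open>m + \<alpha> \<le> 94 * \<sigma>b\<close>, which is below \<open>L\<close>.\<close>
      then have "\<alpha> \<le> 64 * \<sigma>b"
        using m_le \<alpha>_nonneg \<sigma>b_nonneg
        by (cases "\<alpha> = 0") (simp_all add: mult_le_cancel_left)
      moreover have "err Q' $ i = err Q $ i - A" "err Q' $ j = err Q $ j + A"
        by (simp_all add: err_nth Q(1) Q'(1) 2 A_def)
      ultimately have "\<bar>err Q' $ i\<bar> < L" "\<bar>err Q' $ j\<bar> < L"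
        using err_le[of i] err_le[of j] m_le \<sigma>b_le L_pos unfolding \<alpha>_def by linarith+
      then show ?thesis by (rule le_L)
    qed
  qed
qed

text \<open>The exchange from \<open>greedy_swap\<close> competes in the minimum that defines the
  gap, so its guaranteed gain is at most \<open>c * \<sigma>b^2\<close>: a quadratic inequality for
  \<open>m\<close>.\<close>

lemma gap_error_bound:
  assumes Q: "Q \<in> perm_matrices" "real (perm_dist Q (mat 1)) \<le> R"
    and room: "real (perm_dist Q (mat 1)) + 2 \<le> R \<or> perm_supp Ps \<subseteq> perm_supp Q"
    and c: "0 \<le> c" and gap: "local_gap X y R Q \<le> c * \<sigma>b\<^sup>2"
  shows "(norm (err Q))\<^sup>2 \<le> 2 * R * ((64 + 5 * c) * \<sigma>b\<^sup>2)"
proof -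
  define m where "m = infnorm (err Q)"
  obtain T where T: "T \<in> search_nbhd R Q"
    "m / 2 * (19 / 20 * m - 4 * \<sigma>b) \<le> objective X y Q - objective X y T"
    unfolding m_def using greedy_swap[OF Q room] by blast
  have "finite (search_nbhd R Q)"
    using finite_perm_matrices by (rule finite_subset[rotated]) (auto simp: search_nbhd_def)
  then have "(MIN P\<in>search_nbhd R Q. objective X y P) \<le> objective X y T"
    using T(1) by (intro Min_le) auto
  then have decr: "m / 2 * (19 / 20 * m - 4 * \<sigma>b) \<le> c * \<sigma>b\<^sup>2"
    using T(2) gap by (simp add: local_gap_def)
  have m_nonneg: "0 \<le> m" by (simp add: m_def infnorm_pos_le)
  \<comment> \<open>The \<open>64\<close> comes from \<open>m \<le> 8 * \<sigma>b\<close>. For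
    larger \<open>m\<close> the noise term takes at most \<open>1 / 4\<close> of \<open>m^2\<close>,
    and the remaining \<open>19 / 40 - 1 / 4\<close> exceeds \<open>1 / 5\<close>.\<close>
  have "m\<^sup>2 \<le> (64 + 5 * c) * \<sigma>b\<^sup>2"
  proof (cases "m \<le> 8 * \<sigma>b")
    case True
    then have "m\<^sup>2 \<le> (8 * \<sigma>b)\<^sup>2"
      using m_nonneg by (rule power_mono)
    moreover have "0 \<le> 5 * c * \<sigma>b\<^sup>2" using c by simp
    ultimately show ?thesis by (simp add: power_mult_distrib distrib_right)
  next
    case False
    then have "m * (8 * \<sigma>b) \<le> m * m"
      using m_nonneg by (intro mult_left_mono) auto
    moreover have "m / 2 * (19 / 20 * m - 4 * \<sigma>b) = 19 / 40 * m\<^sup>2 - 1 / 4 * (m * (8 * \<sigma>b))"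
      by (simp add: power2_eq_square algebra_simps)
    moreover have "0 \<le> c * \<sigma>b\<^sup>2" using c by simp
    ultimately have "m\<^sup>2 \<le> 5 * (c * \<sigma>b\<^sup>2)"
      using decr unfolding power2_eq_square[of m] by linarith
    moreover have "0 \<le> 64 * \<sigma>b\<^sup>2" by simp
    ultimately show ?thesis unfolding distrib_right mult.assoc by linarith
  qed
  then have "2 * R * m\<^sup>2 \<le> 2 * R * ((64 + 5 * c) * \<sigma>b\<^sup>2)"
    using R_ge(1) by (intro mult_left_mono) auto
  then show ?thesis
    using norm_err_le[OF Q] unfolding m_def by linarith
qed

section \<open>Iterates of the local search\<close>

context
  fixes P :: "nat \<Rightarrow> real^'n^'n"
  assumes iterates: "local_search_iterates X y R P"
begin

lemma iterate_step: "is_arg_min (objective X y) (\<lambda>Q. Q \<in> search_nbhd R (P k)) (P (Suc k))"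
  using iterates by (simp add: local_search_iterates_def)

lemma iterate_feasible: "P k \<in> perm_matrices" "real (perm_dist (P k) (mat 1)) \<le> R"
proof -
  have "P k \<in> perm_matrices \<and> real (perm_dist (P k) (mat 1)) \<le> R"
  proof (cases k)
    case 0
    then show ?thesis
      using iterates R_ge(1) by (simp add: local_search_iterates_def mat_1_perm_matrix)
  next
    case (Suc l)
    then show ?thesis
      using iterate_step[of l] by (auto simp: is_arg_min_def search_nbhd_def)
  qed
  then show "P k \<in> perm_matrices" "real (perm_dist (P k) (mat 1)) \<le> R" by auto
qed

lemma iterate_dist: "perm_dist (P k) (mat 1) \<le> 2 * k"
proof (induction k)
  case 0
  then show ?case using iterates by (simp add: local_search_iterates_def)
next
  case (Suc k)
  have "perm_dist (P (Suc k)) (P k) \<le> 2"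
    using iterate_step[of k] by (auto simp: is_arg_min_def search_nbhd_def)
  then show ?case
    using Suc perm_dist_triangle[of "P (Suc k)" "mat 1" "P k"] by simp
qed

text \<open>While the error is at least \<open>L\<close>, each step gains a fixed multiple of \<open>L\<^sup>2\<close>, and the total gain
  is at most about \<open>r U\<^sup>2\<close>; so the error drops below \<open>L\<close> before the support can fill up.\<close>

lemma early_small_error:
  obtains l where "real (2 * l) + 2 \<le> R" "infnorm (err (P l)) < L"
proof (rule ccontr)
  assume "\<not> thesis"
  then have large: "L \<le> infnorm (err (P l))" if "real (2 * l) + 2 \<le> R" for l
    using that \<open>\<And>l. _ \<Longrightarrow> _ \<Longrightarrow> thesis\<close> by force
  have gain: "46 / 100 * L\<^sup>2 \<le> objective X y (P l) - objective X y (P (Suc l))"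
    if l: "real (2 * l) + 2 \<le> R" for l
  proof -
    define m where "m = infnorm (err (P l))"
    have "L \<le> m" using large[OF l] by (simp add: m_def)
    have "real (perm_dist (P l) (mat 1)) + 2 \<le> R"
      using iterate_dist[of l] l by linarith
    then obtain T where T: "T \<in> search_nbhd R (P l)"
      "m / 2 * (19 / 20 * m - 4 * \<sigma>b) \<le> objective X y (P l) - objective X y T"
      unfolding m_def using greedy_swap[OF iterate_feasible disjI1] by blast
    have "objective X y (P (Suc l)) \<le> objective X y T"
      using iterate_step[of l] T(1) by (auto simp: is_arg_min_def not_less)
    \<comment> \<open>With \<open>m \<ge> L\<close> and \<open>4 * \<sigma>b \<le> L / 40\<close>,
      the second factor is at least \<open>37 / 40 * L\<close>, rounded down to
      \<open>92 / 100 * L\<close>.\<close>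
    moreover have "46 / 100 * L\<^sup>2 \<le> m / 2 * (19 / 20 * m - 4 * \<sigma>b)"
    proof -
      have "L / 2 * (92 / 100 * L) \<le> m / 2 * (19 / 20 * m - 4 * \<sigma>b)"
        using \<open>L \<le> m\<close> \<sigma>b_le L_pos by (intro mult_mono) auto
      then show ?thesis by (simp add: power2_eq_square)
    qed
    ultimately show ?thesis using T(2) by linarith
  qed
  have total: "46 / 100 * L\<^sup>2 * real l \<le> objective X y (P 0) - objective X y (P l)"
    if "real (2 * l) \<le> R" for l
    using that
  proof (induction l)
    case (Suc l)
    then show ?case using gain[of l] by (simp add: distrib_left)
  qed simp
  \<comment> \<open>The largest number of steps such that every step \<open>l < K\<close> satisfies
    \<open>2 * l + 2 \<le> R\<close>.\<close>
  define K where "K = nat \<lfloor>R / 2\<rfloor>"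
  have K: "real (2 * K) \<le> R" "R / 2 - 1 < real K"
    using R_ge(1) by (simp_all add: K_def) linarith+
  have "46 / 100 * L\<^sup>2 * (R / 2 - 1) < 46 / 100 * L\<^sup>2 * real K"
    using K(2) L_pos by (intro mult_strict_left_mono) auto
  also have "\<dots> \<le> objective X y (P 0) - objective X y (P K)"
    by (rule total[OF K(1)])
  also have "\<dots> \<le> real r * U\<^sup>2 * (1 + 1 / 80) + 4 * R * \<sigma>b\<^sup>2"
    using objective_diff_initial objective_diff_ge[OF iterate_feasible, of K] iterates
    by (simp add: local_search_iterates_def)
  \<comment> \<open>The available gain grows in \<open>R\<close> with slope about
    \<open>0.1014 * L^2\<close>, against the \<open>0.23 * L^2\<close> forced by the steps, and at
    \<open>R = 4\<close> the forced gain is already larger.\<close>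
  also have "\<dots> \<le> (R - 4) * L\<^sup>2 / 10 * (1 + 1 / 80) + 4 * R * (L / 160)\<^sup>2"
    using r_L_U \<sigma>b_le \<sigma>b_nonneg R_ge(1)
    by (intro add_mono mult_right_mono mult_left_mono power_mono) auto
  also have "\<dots> = L\<^sup>2 * ((R - 4) / 10 * (1 + 1 / 80) + 4 * R / 25600)"
    by (simp add: power_divide field_simps)
  finally have "L\<^sup>2 * (46 / 100 * (R / 2 - 1))
      < L\<^sup>2 * ((R - 4) / 10 * (1 + 1 / 80) + 4 * R / 25600)"
    by (simp only: mult.assoc mult.left_commute[of "L\<^sup>2"])
  then have "46 / 100 * (R / 2 - 1) < (R - 4) / 10 * (1 + 1 / 80) + 4 * R / 25600"
    using L_pos by simp
  then show False using R_ge(1) by (simp add: field_simps)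
qed

text \<open>Up to the index \<open>l\<close> of \<open>early_small_error\<close> the support has at
  most \<open>2 * l\<close> points. From \<open>l\<close> on the error stays below \<open>L\<close>,
  which puts \<open>perm_supp Ps\<close> inside the support of the iterate.\<close>

lemma iterate_room:
  "real (perm_dist (P k) (mat 1)) + 2 \<le> R \<or> perm_supp Ps \<subseteq> perm_supp (P k)"
proof -
  obtain l where l: "real (2 * l) + 2 \<le> R" "infnorm (err (P l)) < L"
    by (rule early_small_error)
  show ?thesis
  proof (cases "k \<le> l")
    case True
    then show ?thesis using iterate_dist[of k] l(1) by linarith
  next
    case False
    then have "l \<le> k" by simp
    then have "infnorm (err (P k)) < L"
    proof (induction k rule: dec_induct)
      case (step i)
      then show ?case
        using infnorm_err_step[OF iterate_feasible _ iterate_step] by blast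
    qed (rule l(2))
    then show ?thesis
      using supp_Ps_subset iterate_feasible(1) by blast
  qed
qed

end

section \<open>Coefficient and prediction errors\<close>

text \<open>The two vectors can differ only at images of the at most \<open>2 * R\<close> places
  where \<open>Q\<close> and \<open>Ps\<close> disagree, each time by at most
  \<open>2 * infnorm u\<close>. The resulting \<open>8 * R\<close> is enlarged to
  \<open>9 * R\<close> for the sake of the root.\<close>

lemma norm_perm_inverse_diff_le:
  assumes Q: "Q \<in> perm_matrices" "real (perm_dist Q (mat 1)) \<le> R"
  shows "norm (matrix_inv Ps *v u - matrix_inv Q *v u) \<le> 3 * sqrt R * infnorm u"
proof -
  let ?D = "{k. perm_of Q k \<noteq> perm_of Ps k}"
  let ?w = "matrix_inv Ps *v u - matrix_inv Q *v u"
  have "(norm ?w)\<^sup>2 \<le> real (card (perm_of Ps ` ?D)) * (2 * infnorm u)\<^sup>2"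
  proof (rule norm_square_le_card_supp)
    fix j
    obtain k where k: "j = perm_of Ps k"
      using bij_perm_of[OF Ps] by (metis bij_pointE)
    obtain l where l: "j = perm_of Q l"
      using bij_perm_of[OF Q(1)] by (metis bij_pointE)
    have w: "?w $ j = u $ k - u $ l"
      using matrix_inv_perm_matrix_nth[OF Ps, of u k] matrix_inv_perm_matrix_nth[OF Q(1), of u l]
      by (simp add: k[symmetric] l[symmetric])
    then show "\<bar>?w $ j\<bar> \<le> 2 * infnorm u"
      using component_le_infnorm_cart[of u k] component_le_infnorm_cart[of u l] by linarith
    assume "j \<notin> perm_of Ps ` ?D"
    then have "perm_of Q k = perm_of Q l" using k l by auto
    then have "k = l" using bij_perm_of[OF Q(1)] by (metis bij_pointE)
    then show "?w $ j = 0" using w by simp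
  qed
  also have "\<dots> \<le> 2 * R * (2 * infnorm u)\<^sup>2"
    using perm_dist_Ps_le[OF Q(2)] card_image_le[of ?D "perm_of Ps"]
    by (intro mult_right_mono) (auto simp: perm_dist_def)
  also have "\<dots> = 8 * R * (infnorm u)\<^sup>2" by (simp add: power_mult_distrib)
  also have "\<dots> \<le> 9 * R * (infnorm u)\<^sup>2"
    using R_ge(1) by (intro mult_right_mono) auto
  also have "\<dots> = (3 * sqrt R * infnorm u)\<^sup>2"
    using R_ge(1) by (simp add: power_mult_distrib)
  finally show ?thesis
    by (rule power2_le_imp_le) (use R_ge(1) in \<open>auto simp: infnorm_pos_le\<close>)
qed

lemma ls_coeff_error: "ls_coeff X (Q *v y) - \<beta>s = ls_coeff X (err Q) + ls_coeff X \<epsilon>"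
proof -
  have "Q *v y = X *v \<beta>s + (err Q + \<epsilon>)"
    using model by (simp add: err_def)
  then have "ls_coeff X (Q *v y) = ls_coeff X (X *v \<beta>s) + (ls_coeff X (err Q) + ls_coeff X \<epsilon>)"
    unfolding ls_coeff_def by (simp add: matrix_vector_right_distrib)
  then show ?thesis by (simp add: ls_coeff_mult[OF full_rank])
qed

text \<open>Each inverse takes its permuted data back to \<open>y\<close>, which cancels. The rest
  is grouped so that the first term lives on places of disagreement, the second is the projected
  noise, and the third is controlled by \<open>err Q\<close>.\<close>

lemma prediction_error:
  assumes "Q \<in> perm_matrices"
  shows "matrix_inv Q *v (X *v ls_coeff X (Q *v y)) - matrix_inv Ps *v (X *v \<beta>s)
    = (matrix_inv Ps *v \<epsilon> - matrix_inv Q *v \<epsilon>) + matrix_inv Q *v (hat_matrix X *v \<epsilon>)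
      - matrix_inv Q *v (residual_matrix X *v err Q)"
proof -
  have "X *v ls_coeff X (Q *v y) = Q *v y - residual_matrix X *v (err Q + \<epsilon>)"
    using residual_mult[of Q]
    by (metis add_diff_cancel_left' diff_add_cancel hat_matrix_mult residual_matrix_mult)
  also have "\<dots> = Q *v y - residual_matrix X *v err Q - \<epsilon> + hat_matrix X *v \<epsilon>"
    by (simp add: matrix_vector_right_distrib residual_matrix_mult[of X \<epsilon>])
  finally have "matrix_inv Q *v (X *v ls_coeff X (Q *v y))
      = y - matrix_inv Q *v (residual_matrix X *v err Q) - matrix_inv Q *v \<epsilon>
        + matrix_inv Q *v (hat_matrix X *v \<epsilon>)"
    by (simp add: matrix_vector_right_distrib matrix_vector_mult_diff_distrib
        matrix_inv_perm_matrix_cancel[OF assms])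
  moreover have "X *v \<beta>s = Ps *v y - \<epsilon>" using model by simp
  then have "matrix_inv Ps *v (X *v \<beta>s) = y - matrix_inv Ps *v \<epsilon>"
    by (simp add: matrix_vector_mult_diff_distrib matrix_inv_perm_matrix_cancel[OF Ps])
  ultimately show ?thesis by simp
qed

end

section \<open>The two error bounds\<close>

lemma square_add_le: "(a + b :: real)\<^sup>2 \<le> 2 * a\<^sup>2 + 2 * b\<^sup>2"
  using zero_le_power2[of "a - b"] by (simp add: power2_sum power2_diff)

theorem theorem3p8:
  fixes X :: "real^'d^'n" and y \<epsilon> :: "real^'n" and \<beta>s :: "real^'d" and Ps :: "real^'n^'n"
    and n d R U L C\<^sub>0 C\<^sub>1 \<rho> \<sigma>b \<sigma> \<gamma>b c cb :: real and r k :: nat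
    and P :: "nat \<Rightarrow> real^'n^'n" and \<beta> :: "real^'d"
  assumes n_def: "n = real CARD('n)" and d_def: "d = real CARD('d)"
    and n_gt_d: "CARD('n) > CARD('d)"
    and full_rank: "rank X = CARD('d)"
    and Ps: "Ps \<in> perm_matrices"
    and model: "Ps *v y = X *v \<beta>s + \<epsilon>"
    and dist_Ps: "perm_dist Ps (mat 1) \<le> r"
    and A1: "U > L" "L > 0"
      "(MAX i. MAX j. \<bar>y $ i - y $ j\<bar>) \<le> U"
      "\<forall>i\<in>perm_supp Ps. \<bar>(Ps *v y) $ i - y $ i\<bar> \<ge> L"
    and A2: "C\<^sub>1 > 1" "R = 10 * C\<^sub>1 * real r * U\<^sup>2 / L\<^sup>2 + 4"
    and A3: "C\<^sub>0 > 0" "\<rho> \<le> C\<^sub>0 * d * ln n / n"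
      "R * \<rho> \<le> L\<^sup>2 / (90 * U\<^sup>2)"
      "\<forall>u\<in>sparse_vectors 4. (norm (hat_matrix X *v u))\<^sup>2 \<le> \<rho> * (norm u)\<^sup>2"
      "\<forall>u\<in>sparse_vectors (2 * R). (norm (hat_matrix X *v u))\<^sup>2 \<le> R * \<rho> * (norm u)\<^sup>2"
    and A4: "\<sigma>b \<ge> 0"
      "\<sigma>b \<le> min (1 / 2) ((\<rho> * d) powr (- 1 / 2)) * (L\<^sup>2 / (80 * U))"
      "infnorm (residual_matrix X *v \<epsilon>) \<le> \<sigma>b"
      "infnorm \<epsilon> \<le> \<sigma>b"
      "norm (hat_matrix X *v \<epsilon>) \<le> sqrt d * \<sigma>b"
    and B1: "R\<^sup>2 * \<rho> \<le> 1 / 10"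
    and B2: "\<sigma> \<ge> 0"
      "\<sigma>b\<^sup>2 \<le> \<sigma>\<^sup>2 * min (n / (660 * R\<^sup>2)) (n / (5 * d * R))"
      "(norm (residual_matrix X *v \<epsilon>))\<^sup>2 \<ge> 1 / 2 * n * \<sigma>\<^sup>2"
    and C: "\<gamma>b > 0"
      "lambda_min ((1 / n) *\<^sub>R (transpose X ** X)) \<ge> \<gamma>b"
      "norm (ls_coeff X \<epsilon>) \<le> \<sigma>b * sqrt (d / (n * \<gamma>b))"
    and iterates: "local_search_iterates X y R P"
    and gap: "c > 0" "local_gap X y R (P k) \<le> c * \<sigma>b\<^sup>2"
    and \<beta>_def: "\<beta> = ls_coeff X (P k *v y)"
    and cb_def: "cb = 800 + 10 * c"
  shows "(norm (\<beta> - \<beta>s))\<^sup>2 \<le> 4 * inverse \<gamma>b * cb * (R * \<sigma>b\<^sup>2 / n) + 2 * inverse \<gamma>b * (d * \<sigma>b\<^sup>2 / n)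
    \<and> 1 / n * (norm (matrix_inv (P k) *v (X *v \<beta>) - matrix_inv Ps *v (X *v \<beta>s)))\<^sup>2
        \<le> 2 * (sqrt (2 * cb) + 3)\<^sup>2 * (R * \<sigma>b\<^sup>2 / n) + 2 * d * \<sigma>b\<^sup>2 / n"
proof -
  have n: "0 < n" by (simp add: n_def)
  have d: "0 \<le> d" by (simp add: d_def)
  have U: "0 < U" using A1 by simp
  interpret mismatched_regression X y \<epsilon> \<beta>s Ps R U L \<rho> \<sigma>b r
  proof
    show "\<bar>y $ i - y $ j\<bar> \<le> U" for i j
    proof -
      have "\<bar>y $ i - y $ j\<bar> \<le> (MAX j. \<bar>y $ i - y $ j\<bar>)"
        by (rule Max_ge) auto
      also have "\<dots> \<le> (MAX i. MAX j. \<bar>y $ i - y $ j\<bar>)"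
        by (rule Max_ge) auto
      finally show ?thesis using A1(3) by linarith
    qed
    have "1 * (10 * real r * U\<^sup>2 / L\<^sup>2) \<le> C\<^sub>1 * (10 * real r * U\<^sup>2 / L\<^sup>2)"
      using A2(1) by (intro mult_right_mono) auto
    then show "10 * real r * U\<^sup>2 / L\<^sup>2 + 4 \<le> R"
      using A2(2) by (simp add: mult_ac)
    have "L\<^sup>2 \<le> U\<^sup>2" using A1 by (intro power_mono) auto
    then have "L\<^sup>2 / (90 * U\<^sup>2) \<le> 1 / 90"
      using U by (simp add: field_simps)
    then show "R * \<rho> \<le> 1 / 90" using A3(3) by linarith
    have "\<sigma>b \<le> 1 / 2 * (L\<^sup>2 / (80 * U))"
      by (rule order_trans[OF A4(2)]) (use U in \<open>intro mult_right_mono, auto\<close>)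
    then have "160 * \<sigma>b \<le> L * (L / U)" by (simp add: power2_eq_square)
    also have "\<dots> \<le> L * 1"
      using A1 U by (intro mult_left_mono) auto
    finally show "160 * \<sigma>b \<le> L" by simp
  qed (use full_rank Ps model dist_Ps A1 A3 A4 in auto)
  note feasible = iterate_feasible[OF iterates, of k]
  let ?v = "err (P k)"
  have cb: "0 < cb" using cb_def gap(1) by simp
  have "(norm ?v)\<^sup>2 \<le> 2 * R * ((64 + 5 * c) * \<sigma>b\<^sup>2)"
    by (rule gap_error_bound[OF feasible iterate_room[OF iterates] _ gap(2)]) (use gap(1) in simp)
  also have "\<dots> \<le> 2 * R * (cb * \<sigma>b\<^sup>2)"
    using R_ge(1) gap(1) by (intro mult_left_mono mult_right_mono) (auto simp: cb_def)
  finally have v_le: "(norm ?v)\<^sup>2 \<le> 2 * cb * (R * \<sigma>b\<^sup>2)" by (simp add: mult_ac)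
  have "(norm (\<beta> - \<beta>s))\<^sup>2 \<le> 4 * inverse \<gamma>b * cb * (R * \<sigma>b\<^sup>2 / n) + 2 * inverse \<gamma>b * (d * \<sigma>b\<^sup>2 / n)"
  proof -
    have "n * \<gamma>b * (norm (ls_coeff X ?v))\<^sup>2 \<le> (norm (hat_matrix X *v ?v))\<^sup>2"
      by (rule norm_ls_coeff_le[OF n C(2)])
    \<comment> \<open>As \<open>R * \<rho>\<close> is at most \<open>1\<close>, the hat matrix does
      not enlarge the error.\<close>
    also have "\<dots> \<le> 1 * (norm ?v)\<^sup>2"
      by (rule order_trans[OF hat_err_le[OF feasible]])
        (use R_\<rho> in \<open>intro mult_right_mono, auto\<close>)
    finally have "n * \<gamma>b * (norm (ls_coeff X ?v))\<^sup>2 \<le> 2 * cb * (R * \<sigma>b\<^sup>2)"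
      using v_le by simp
    then have ls_v: "(norm (ls_coeff X ?v))\<^sup>2 \<le> 2 * inverse \<gamma>b * cb * (R * \<sigma>b\<^sup>2 / n)"
      using n C(1) by (simp add: field_simps)
    have "(norm (ls_coeff X \<epsilon>))\<^sup>2 \<le> (\<sigma>b * sqrt (d / (n * \<gamma>b)))\<^sup>2"
      using C(3) by (intro power_mono) auto
    also have "\<dots> = inverse \<gamma>b * (d * \<sigma>b\<^sup>2 / n)"
      using d n C(1) by (simp add: power_mult_distrib field_simps)
    finally have ls_\<epsilon>: "(norm (ls_coeff X \<epsilon>))\<^sup>2 \<le> inverse \<gamma>b * (d * \<sigma>b\<^sup>2 / n)" .
    have "(norm (\<beta> - \<beta>s))\<^sup>2 \<le> (norm (ls_coeff X ?v) + norm (ls_coeff X \<epsilon>))\<^sup>2"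
      unfolding \<beta>_def ls_coeff_error by (intro power_mono norm_triangle_ineq) auto
    also have "\<dots> \<le> 2 * (norm (ls_coeff X ?v))\<^sup>2 + 2 * (norm (ls_coeff X \<epsilon>))\<^sup>2"
      by (rule square_add_le)
    finally show ?thesis using ls_v ls_\<epsilon> by linarith
  qed
  moreover have "1 / n * (norm (matrix_inv (P k) *v (X *v \<beta>) - matrix_inv Ps *v (X *v \<beta>s)))\<^sup>2
      \<le> 2 * (sqrt (2 * cb) + 3)\<^sup>2 * (R * \<sigma>b\<^sup>2 / n) + 2 * d * \<sigma>b\<^sup>2 / n"
  proof -
    have "norm ?v \<le> sqrt (2 * cb * (R * \<sigma>b\<^sup>2))"
      using v_le by (rule real_le_rsqrt)
    also have "\<dots> = sqrt (2 * cb) * (sqrt R * \<sigma>b)"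
      using A4(1) by (simp add: real_sqrt_mult)
    finally have fit: "norm (matrix_inv (P k) *v (residual_matrix X *v ?v))
        \<le> sqrt (2 * cb) * (sqrt R * \<sigma>b)"
      unfolding norm_matrix_inv_perm_matrix[OF feasible(1)]
      using norm_residual_le[OF full_rank, of ?v] by linarith
    have "3 * sqrt R * infnorm \<epsilon> \<le> 3 * sqrt R * \<sigma>b"
      using A4(4) R_ge(1) by (intro mult_left_mono) auto
    then have mismatch: "norm (matrix_inv Ps *v \<epsilon> - matrix_inv (P k) *v \<epsilon>) \<le> 3 * (sqrt R * \<sigma>b)"
      using norm_perm_inverse_diff_le[OF feasible, of \<epsilon>] by linarith
    have hat: "norm (matrix_inv (P k) *v (hat_matrix X *v \<epsilon>)) \<le> sqrt d * \<sigma>b"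
      using A4(5) by (simp add: norm_matrix_inv_perm_matrix[OF feasible(1)])
    have "norm (matrix_inv (P k) *v (X *v \<beta>) - matrix_inv Ps *v (X *v \<beta>s))
        \<le> norm (matrix_inv Ps *v \<epsilon> - matrix_inv (P k) *v \<epsilon>)
          + norm (matrix_inv (P k) *v (hat_matrix X *v \<epsilon>))
          + norm (matrix_inv (P k) *v (residual_matrix X *v ?v))"
      unfolding \<beta>_def prediction_error[OF feasible(1)]
      by (meson add_mono norm_triangle_ineq norm_triangle_ineq4 order_refl order_trans)
    \<comment> \<open>The remaining error gives \<open>sqrt (2 * cb)\<close> and the mismatched
      noise gives \<open>3\<close>, both in units of \<open>sqrt R * \<sigma>b\<close>; the
      projected noise is kept apart and costs a factor 2 on squaring.\<close>
    also have "\<dots> \<le> (sqrt (2 * cb) + 3) * (sqrt R * \<sigma>b) + sqrt d * \<sigma>b"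
      using fit mismatch hat by (simp add: distrib_right)
    finally have "(norm (matrix_inv (P k) *v (X *v \<beta>) - matrix_inv Ps *v (X *v \<beta>s)))\<^sup>2
        \<le> ((sqrt (2 * cb) + 3) * (sqrt R * \<sigma>b) + sqrt d * \<sigma>b)\<^sup>2"
      by (intro power_mono) auto
    also have "\<dots> \<le> 2 * ((sqrt (2 * cb) + 3) * (sqrt R * \<sigma>b))\<^sup>2 + 2 * (sqrt d * \<sigma>b)\<^sup>2"
      by (rule square_add_le)
    also have "\<dots> = 2 * (sqrt (2 * cb) + 3)\<^sup>2 * (R * \<sigma>b\<^sup>2) + 2 * d * \<sigma>b\<^sup>2"
      using d R_ge(1) by (simp add: power_mult_distrib)
    finally show ?thesis
      using n by (simp add: field_simps)
  qed
  ultimately show ?thesis ..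
qed

end
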